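(* Let $M^2_g$ be an arbitrary compact Riemann surface of genus $g\ge1$, and let $n\ge2$. Let $$f_{\mathbb{Q}}:\Lambda_{\mathbb{Q}}\langle x_1,\ldots,x_g,x'_1,\ldots,x'_g\rangle\otimes\mathbb{Q}[y]\to H^*(\mathrm{Sym}^nM^2_g;\mathbb{Q}),\qquad x_i\mapsto\xi_i,\ x'_i\mapsto\xi'_i\ (1\le i\le g),\ y\mapsto\eta,$$ be the $\mathbb{Q}$-algebra epimorphism described in the context, and let $I^*_{Mac}:=\mathrm{Ker}(f_{\mathbb{Q}})$. Consider the $\binom{2g}{n+1}$ polynomials (the "polynomials with $q=0$") $$x_{i_1}\cdots x_{i_a}\,x'_{j_1}\cdots x'_{j_b}\,(y-x_{k_1}x'_{k_1})\cdots(y-x_{k_c}x'_{k_c}),$$ where $a,b,c\ge0$, $a+b+2c=n+1$, and $i_1<\cdots<i_a$, $j_1<\cdots<j_b$, $k_1<\cdots<k_c$ are $a+b+c$ distinct integers from $1$ to $g$ inclusive. Then: (A) If $n\in\{3,5,\ldots,2g-3\}$, then the ideal $I^*_{Mac}$ is generated by the $\binom{2g}{n+1}$ polynomials with $q=0$, and none of these polynomials can be removed (the ideal generated by the remaining ones is strictly smaller than $I^*_{Mac}$). (B) If $n\in\{2,4,\ldots,2g-2\}$, then the ideal $I^*_{Mac}$ is generated by the $\binom{2g}{n+1}$ polynomials with $q=0$ together with the one further polynomial $$(y-x_1x'_1)(y-x_2x'_2)\cdots(y-x_{n/2}x'_{n/2})\,y,$$ and none of these $\binom{2g}{n+1}+1$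 polynomials can be removed (in the same sense).
   Context: $\mathrm{Sym}^nM:=M^n/S_n$ is the $n$-th symmetric product. The projection $\pi_n:M^n\to\mathrm{Sym}^nM$ induces an isomorphism $H^*(\mathrm{Sym}^nM;\mathbb{Q})\cong(H^*(M;\mathbb{Q})^{\otimes n})^{S_n}$ ($S_n$ acting with Koszul signs), by which these rings are identified. Fix a basis $H^*(M^2_g;\mathbb{Z})=\mathbb{Z}\langle1\rangle\oplus\mathbb{Z}\langle\alpha_1,\ldots,\alpha_{2g}\rangle\oplus\mathbb{Z}\langle\beta\rangle$ with $|\alpha_i|=1$, $|\beta|=2$, $\alpha_i\alpha_{i+g}=-\alpha_{i+g}\alpha_i=\beta$ for $1\le i\le g$, and all other products of the $\alpha$'s and $\beta$ equal to zero. For a class $\gamma$ put $\chi(\gamma)=\gamma\otimes1\otimes\cdots\otimes1+\cdots+1\otimes\cdots\otimes1\otimes\gamma$, and set $\xi_i=\chi(\alpha_i)$, $\xi'_i=\chi(\alpha_{i+g})$ for $1\le i\le g$, and $\eta=\chi(\beta)$. $\Lambda_{\mathbb{Q}}\langle x_1,\ldots,x_g,x'_1,\ldots,x'_g\rangle\otimes\mathbb{Q}[y]$ is the free graded commutative $\mathbb{Q}$-algebra on formal variables with $|x_i|=|x'_i|=1$ and $|y|=2$. It is a known theorem of Macdonald that $f_{\mathbb{Q}}$ is surjective and that $\mathrm{Ker}(f_{\mathbb{Q}})$ is generated by the polynomials $x_{i_1}\cdots x_{i_a}x'_{j_1}\cdots x'_{j_b}(y-x_{k_1}x'_{k_1})\cdots(y-x_{k_c}x'_{k_c})y^q$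 with $a,b,c,q\ge 0$, $a+b+2c+q=n+1$ and $i_1,\ldots,i_a,j_1,\ldots,j_b,k_1,\ldots,k_c$ distinct integers from $1$ to $g$. *)

theory Defs
  imports
    "HOL-Algebra.RingHom"
    "HOL-Combinatorics.Permutations"
    "HOL-Computational_Algebra.Polynomial"
begin

definition list_prod :: "('a, 'b) monoid_scheme \<Rightarrow> 'a list \<Rightarrow> 'a" where
  "list_prod R as = foldr (\<lambda>a b. a \<otimes>\<^bsub>R\<^esub> b) as \<one>\<^bsub>R\<^esub>"

text \<open>
  The cohomology ring of a closed oriented surface of genus \<open>g\<close>. A class is its family of
  coordinates in the basis \<open>1, \<alpha>\<^sub>1, \<dots>, \<alpha>\<^sub>2\<^sub>g, \<beta>\<close>.
\<close>

datatype cls = One | Alpha nat | Beta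

definition surface_basis :: "nat \<Rightarrow> cls set" where
  "surface_basis g = {One, Beta} \<union> Alpha ` {1..2 * g}"

fun cls_deg :: "cls \<Rightarrow> nat" where
  "cls_deg One = 0"
| "cls_deg (Alpha i) = 1"
| "cls_deg Beta = 2"

definition single :: "cls \<Rightarrow> cls \<Rightarrow> rat" where
  "single c = (\<lambda>d. if d = c then 1 else 0)"

fun cup_basis :: "nat \<Rightarrow> cls \<Rightarrow> cls \<Rightarrow> cls \<Rightarrow> rat" where
  "cup_basis g One b = single b"
| "cup_basis g a One = single a"
| "cup_basis g (Alpha i) (Alpha j) =
     (if i \<in> {1..g} \<and> j = i + g then single Beta
      else if j \<in> {1..g} \<and> i = j + g then (\<lambda>c. - single Beta c)
      else (\<lambda>c. 0))"
| "cup_basis g a b = (\<lambda>c. 0)"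

definition surface_cohomology :: "nat \<Rightarrow> (cls \<Rightarrow> rat) ring" where
  "surface_cohomology g =
     \<lparr>carrier = {u. \<forall>c. c \<notin> surface_basis g \<longrightarrow> u c = 0},
      monoid.mult = (\<lambda>u v c. \<Sum>a\<in>surface_basis g. \<Sum>b\<in>surface_basis g. u a * v b * cup_basis g a b c),
      one = single One,
      zero = (\<lambda>c. 0),
      add = (\<lambda>u v c. u c + v c)\<rparr>"

text \<open>
  The \<open>n\<close>-th graded tensor power of this ring. Its basis is indexed by the words
  \<open>[c\<^sub>0, \<dots>, c\<^sub>n\<^sub>-\<^sub>1]\<close> of basis classes, standing for \<open>c\<^sub>0 \<otimes> \<dots> \<otimes> c\<^sub>n\<^sub>-\<^sub>1\<close>, and an
  element is its family of coordinates. The product of two basis tensors is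
  \<open>(a\<^sub>0 \<otimes> \<dots> \<otimes> a\<^sub>n\<^sub>-\<^sub>1) (b\<^sub>0 \<otimes> \<dots> \<otimes> b\<^sub>n\<^sub>-\<^sub>1) = \<plusminus> a\<^sub>0 b\<^sub>0 \<otimes> \<dots> \<otimes> a\<^sub>n\<^sub>-\<^sub>1 b\<^sub>n\<^sub>-\<^sub>1\<close>, with a sign
  \<open>(-1)^(|a\<^sub>i| |b\<^sub>j|)\<close> for every \<open>b\<^sub>j\<close> that moves past an \<open>a\<^sub>i\<close> with \<open>j < i\<close>.
\<close>

definition tensor_basis :: "nat \<Rightarrow> nat \<Rightarrow> cls list set" where
  "tensor_basis g n = {w. length w = n \<and> set w \<subseteq> surface_basis g}"

definition pure_tensor :: "(cls \<Rightarrow> rat) list \<Rightarrow> cls list \<Rightarrow> rat" where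
  "pure_tensor us w =
     (if length w = length us then \<Prod>k<length us. (us ! k) (w ! k) else 0)"

definition mult_sign :: "cls list \<Rightarrow> cls list \<Rightarrow> rat" where
  "mult_sign a b = (-1) ^ (\<Sum>i<length a. \<Sum>j<i. cls_deg (a ! i) * cls_deg (b ! j))"

definition tensor_power :: "nat \<Rightarrow> nat \<Rightarrow> (cls list \<Rightarrow> rat) ring" where
  "tensor_power g n =
     \<lparr>carrier = {u. \<forall>w. w \<notin> tensor_basis g n \<longrightarrow> u w = 0},
      monoid.mult = (\<lambda>u v w. \<Sum>a\<in>tensor_basis g n. \<Sum>b\<in>tensor_basis g n.
                u a * v b * mult_sign a b *
                pure_tensor (map2 (\<lambda>c d. single c \<otimes>\<^bsub>surface_cohomology g\<^esub> single d) a b) w),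
      one = pure_tensor (replicate n \<one>\<^bsub>surface_cohomology g\<^esub>),
      zero = (\<lambda>w. 0),
      add = (\<lambda>u v w. u w + v w)\<rparr>"

text \<open>
  A permutation \<open>\<sigma>\<close> of the positions moves the factor at position \<open>i\<close> to position \<open>\<sigma> i\<close>, with
  the Koszul sign of the inversions. The word carried to \<open>w\<close> by \<open>\<sigma>\<close> is \<open>permute_list \<sigma> w\<close>.
\<close>

definition perm_sign :: "(nat \<Rightarrow> nat) \<Rightarrow> cls list \<Rightarrow> rat" where
  "perm_sign \<sigma> a =
     (-1) ^ (\<Sum>(i, j)\<in>{(i, j). i < j \<and> j < length a \<and> \<sigma> j < \<sigma> i}. cls_deg (a ! i) * cls_deg (a ! j))"

definition perm_act :: "(nat \<Rightarrow> nat) \<Rightarrow> (cls list \<Rightarrow> rat) \<Rightarrow> cls list \<Rightarrow> rat" where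
  "perm_act \<sigma> u = (\<lambda>w. perm_sign \<sigma> (permute_list \<sigma> w) * u (permute_list \<sigma> w))"

text \<open>
  The rational cohomology ring of the \<open>n\<close>-th symmetric product of the surface, identified
  with the ring of invariants of the symmetric group in the tensor power.
\<close>

definition sym_cohomology :: "nat \<Rightarrow> nat \<Rightarrow> (cls list \<Rightarrow> rat) ring" where
  "sym_cohomology g n =
     (tensor_power g n)
       \<lparr>carrier := {u \<in> carrier (tensor_power g n). \<forall>\<sigma>. \<sigma> permutes {..<n} \<longrightarrow> perm_act \<sigma> u = u}\<rparr>"

definition chi :: "nat \<Rightarrow> nat \<Rightarrow> (cls \<Rightarrow> rat) \<Rightarrow> cls list \<Rightarrow> rat" where
  "chi g n \<gamma> = (\<lambda>w. \<Sum>k<n. pure_tensor ((replicate n \<one>\<^bsub>surface_cohomology g\<^esub>)[k := \<gamma>]) w)"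

definition xi :: "nat \<Rightarrow> nat \<Rightarrow> nat \<Rightarrow> cls list \<Rightarrow> rat" where
  "xi g n i = chi g n (single (Alpha i))"

definition xi' :: "nat \<Rightarrow> nat \<Rightarrow> nat \<Rightarrow> cls list \<Rightarrow> rat" where
  "xi' g n i = chi g n (single (Alpha (i + g)))"

definition eta :: "nat \<Rightarrow> nat \<Rightarrow> cls list \<Rightarrow> rat" where
  "eta g n = chi g n (single Beta)"

text \<open>
  The free graded commutative algebra on \<open>x\<^sub>1, \<dots>, x\<^sub>g, x'\<^sub>1, \<dots>, x'\<^sub>g\<close> of degree 1 and \<open>y\<close> of
  degree 2, as the exterior algebra with coefficients in the polynomial ring in \<open>y\<close>. The odd
  variables are numbered \<open>1, \<dots>, 2g\<close> in the order listed, so \<open>x'\<^sub>i\<close> has number \<open>i + g\<close>. An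
  element \<open>p\<close> stands for the sum, over the sets \<open>S\<close> of such numbers, of \<open>p S\<close> times the product
  of the variables in \<open>S\<close> in increasing order. The sign \<open>shuffle_sign S T\<close> comes from sorting
  the concatenation of two such products.
\<close>

definition shuffle_sign :: "nat set \<Rightarrow> nat set \<Rightarrow> rat" where
  "shuffle_sign S T = (-1) ^ card {(s, t). s \<in> S \<and> t \<in> T \<and> t < s}"

definition free_gca :: "nat \<Rightarrow> (nat set \<Rightarrow> rat poly) ring" where
  "free_gca g =
     \<lparr>carrier = {p. \<forall>S. \<not> S \<subseteq> {1..2 * g} \<longrightarrow> p S = 0},
      monoid.mult = (\<lambda>p q U. \<Sum>S\<in>Pow U. smult (shuffle_sign S (U - S)) (p S * q (U - S))),
      one = (\<lambda>S. if S = {} then 1 else 0),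
      zero = (\<lambda>S. 0),
      add = (\<lambda>p q S. p S + q S)\<rparr>"

definition var_x :: "nat \<Rightarrow> nat set \<Rightarrow> rat poly" where
  "var_x i = (\<lambda>S. if S = {i} then 1 else 0)"

definition var_x' :: "nat \<Rightarrow> nat \<Rightarrow> nat set \<Rightarrow> rat poly" where
  "var_x' g i = (\<lambda>S. if S = {i + g} then 1 else 0)"

definition var_y :: "nat set \<Rightarrow> rat poly" where
  "var_y = (\<lambda>S. if S = {} then [:0, 1:] else 0)"

text \<open>
  The algebra homomorphism with \<open>x\<^sub>i \<mapsto> \<xi>\<^sub>i\<close>, \<open>x'\<^sub>i \<mapsto> \<xi>'\<^sub>i\<close>, \<open>y \<mapsto> \<eta>\<close>, written out on the basis
  of monomials: an increasing product of odd variables times \<open>y\<^sup>q\<close> goes to the corresponding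
  product of images.
\<close>

definition odd_image :: "nat \<Rightarrow> nat \<Rightarrow> nat \<Rightarrow> cls list \<Rightarrow> rat" where
  "odd_image g n i = (if i \<le> g then xi g n i else xi' g n (i - g))"

definition macdonald_map :: "nat \<Rightarrow> nat \<Rightarrow> (nat set \<Rightarrow> rat poly) \<Rightarrow> cls list \<Rightarrow> rat" where
  "macdonald_map g n p =
     (\<lambda>w. \<Sum>S\<in>Pow {1..2 * g}. \<Sum>q\<le>degree (p S). coeff (p S) q *
            (list_prod (sym_cohomology g n) (map (odd_image g n) (sorted_list_of_set S))
               \<otimes>\<^bsub>sym_cohomology g n\<^esub> (eta g n [^]\<^bsub>sym_cohomology g n\<^esub> q)) w)"

definition macdonald_ideal :: "nat \<Rightarrow> nat \<Rightarrow> (nat set \<Rightarrow> rat poly) set" where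
  "macdonald_ideal g n = a_kernel (free_gca g) (sym_cohomology g n) (macdonald_map g n)"

definition y_minus_xx' :: "nat \<Rightarrow> nat \<Rightarrow> nat set \<Rightarrow> rat poly" where
  "y_minus_xx' g k = var_y \<ominus>\<^bsub>free_gca g\<^esub> (var_x k \<otimes>\<^bsub>free_gca g\<^esub> var_x' g k)"

definition macdonald_poly :: "nat \<Rightarrow> nat set \<Rightarrow> nat set \<Rightarrow> nat set \<Rightarrow> nat set \<Rightarrow> rat poly" where
  "macdonald_poly g I J K =
     list_prod (free_gca g)
       (map var_x (sorted_list_of_set I) @ map (var_x' g) (sorted_list_of_set J) @
        map (y_minus_xx' g) (sorted_list_of_set K))"

definition macdonald_polys :: "nat \<Rightarrow> nat \<Rightarrow> (nat set \<Rightarrow> rat poly) set" where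
  "macdonald_polys g n =
     {macdonald_poly g I J K | I J K.
        I \<subseteq> {1..g} \<and> J \<subseteq> {1..g} \<and> K \<subseteq> {1..g} \<and>
        I \<inter> J = {} \<and> I \<inter> K = {} \<and> J \<inter> K = {} \<and>
        card I + card J + 2 * card K = n + 1}"

definition extra_poly :: "nat \<Rightarrow> nat \<Rightarrow> nat set \<Rightarrow> rat poly" where
  "extra_poly g n =
     list_prod (free_gca g) (map (y_minus_xx' g) [1..<n div 2 + 1]) \<otimes>\<^bsub>free_gca g\<^esub> var_y"

end

theory Submission
  imports Defs
begin

text \<open>
  Put \<open>z\<^sub>k = y - x\<^sub>k x'\<^sub>k\<close>. The products of distinct variables in which every pair
  \<open>x\<^sub>k x'\<^sub>k\<close> is replaced by \<open>z\<^sub>k\<close> form a basis \<open>(e\<^sub>S)\<close> of the algebra over \<open>\<rat>[y]\<close>, indexed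
  by the sets \<open>S\<close> of odd variables. The \<open>e\<^sub>S\<close> with \<open>|S| = n + 1\<close> are up to sign the polynomials
  with \<open>q = 0\<close>. Since \<open>z\<^sub>k\<close> maps to the sum over distinct positions only, \<open>e\<^sub>S y\<^sup>q\<close> maps to
  \<open>\<plusminus>q!\<close> times the signed sum of all words containing every \<open>\<alpha>\<^sub>s\<close>, \<open>s \<in> S\<close>, once and \<open>\<beta>\<close>
  exactly \<open>q\<close> times. These sums have disjoint supports, and such words exist iff
  \<open>|S| + q \<le> n\<close>; hence the kernel is spanned by the \<open>e\<^sub>S y\<^sup>q\<close> with \<open>|S| + q > n\<close>.

  Writing \<open>i'\<close> for the partner of \<open>i\<close>, multiplication acts by
  \<open>x\<^sub>i e\<^sub>S = \<plusminus>e\<^bsub>S + i\<^esub> \<plusminus> y e\<^bsub>S - i'\<^esub>\<close>, where a term is absent if \<open>i \<in> S\<close>, respectively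
  \<open>i' \<notin> S\<close>. These relations produce all \<open>e\<^sub>S y\<^sup>q\<close> of the kernel from those with
  \<open>|S| = n + 1\<close>, except that a union \<open>S\<close> of pairs with \<open>|S| = n\<close> yields only relations between
  the classes of the \<open>e\<^sub>S y\<close>; one additional generator settles all of them. A generator \<open>e\<^sub>S\<close> is
  irredundant because requiring its coefficient to be divisible by \<open>y\<close> still defines an ideal.
  The additional one is irredundant because all others vanish at \<open>x = x' = 0\<close>.
\<close>

subsection \<open>Exterior multiplication, contraction and their Clifford deformation\<close>

text \<open>The sign of moving the variable \<open>i\<close> from the front of the increasing
  product over \<open>S\<close> to its place. It is polymorphic because it occurs both among the
  rational coefficients of words and among the polynomial coefficients of the algebra.\<close>

definition sg :: "nat \<Rightarrow> nat set \<Rightarrow> 'a::comm_ring_1" where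
  "sg i S = (-1) ^ card {t \<in> S. t < i}"

lemma sg_insert: "j \<notin> S \<Longrightarrow> sg i (insert j S) = (if j < i then - sg i S else sg i S)"
proof -
  assume j: "j \<notin> S"
  have "{t \<in> insert j S. t < i} = (if j < i then insert j {t \<in> S. t < i} else {t \<in> S. t < i})"
    by auto
  with j show ?thesis by (auto simp: sg_def)
qed

lemma sg_remove: "j \<in> S \<Longrightarrow> sg i (S - {j}) = (if j < i then - sg i S else sg i S)"
  using sg_insert[of j "S - {j}" i, where ?'a = 'a] by (auto simp: insert_absorb)

lemma sg_sq [simp]: "sg i S * sg i S = 1"
  by (simp add: sg_def flip: power_add mult_2)

lemma sg_sq_left [simp]: "sg i S * (sg i S * a) = a"
  by (simp flip: mult.assoc)

lemma sg_below: "(\<And>t. t \<in> S \<Longrightarrow> i \<le> t) \<Longrightarrow> sg i S = 1"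
proof -
  assume "\<And>t. t \<in> S \<Longrightarrow> i \<le> t"
  then have "{t \<in> S. t < i} = {}" by fastforce
  then show ?thesis unfolding sg_def by (simp only: card.empty power_0)
qed

lemma sg_singleton [simp]: "sg i {i} = 1"
  by (rule sg_below) simp

text \<open>Coordinates of left multiplication by x_i. The sign may be taken at \<open>U\<close>
  instead of \<open>U - {i}\<close>, because only elements strictly below \<open>i\<close>
  count.\<close>

definition wedge :: "nat \<Rightarrow> (nat set \<Rightarrow> 'a) \<Rightarrow> nat set \<Rightarrow> 'a::comm_ring_1" where
  "wedge i p = (\<lambda>U. if i \<in> U then sg i U * p (U - {i}) else 0)"

definition contract :: "nat \<Rightarrow> (nat set \<Rightarrow> 'a) \<Rightarrow> nat set \<Rightarrow> 'a::comm_ring_1" where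
  "contract i p = (\<lambda>U. if i \<in> U then 0 else sg i U * p (insert i U))"

lemma wedge_wedge: "wedge i (wedge j p) U = - wedge j (wedge i p) U"
  by (auto simp: wedge_def sg_remove Diff_insert2[symmetric] insert_commute)

lemma wedge_wedge_same [simp]: "wedge i (wedge i p) U = 0"
  by (simp add: wedge_def)

lemma contract_contract: "contract i (contract j p) U = - contract j (contract i p) U"
  by (auto simp: contract_def sg_insert insert_commute)

lemma contract_contract_same [simp]: "contract i (contract i p) U = 0"
  by (simp add: contract_def)

text \<open>The canonical anticommutation relation. With \<open>wedge_wedge\<close> and
  \<open>contract_contract\<close> it determines how the deformed operators below commute.\<close>

lemma contract_wedge:
  "contract i (wedge j p) U = (if i = j then p U else 0) - wedge j (contract i p) U"
  by (auto simp: wedge_def contract_def sg_insert sg_remove insert_Diff_if insert_absorb)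

section \<open>Dual pairs of variables and the deformed multiplication\<close>

definition partner :: "nat \<Rightarrow> nat \<Rightarrow> nat" where
  "partner g i = (if i \<le> g then i + g else i - g)"

text \<open>With \<open>partner\<close> this encodes the intersection form: \<alpha>_i times the
  \<alpha> of its partner is \<open>orient g i\<close> times \<beta>, and all other products of two
  \<alpha> vanish.\<close>

definition orient :: "nat \<Rightarrow> nat \<Rightarrow> 'a::comm_ring_1" where
  "orient g i = (if i \<le> g then 1 else -1)"

lemma partner_in [simp]: "i \<in> {1..2*g} \<Longrightarrow> partner g i \<in> {1..2*g}"
  and partner_partner [simp]: "i \<in> {1..2*g} \<Longrightarrow> partner g (partner g i) = i"
  and partner_neq [simp]: "i \<in> {1..2*g} \<Longrightarrow> partner g i \<noteq> i"
  and orient_partner [simp]: "i \<in> {1..2*g} \<Longrightarrow> orient g (partner g i) = (- orient g i :: 'a::comm_ring_1)"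
  by (auto simp: partner_def orient_def)

lemma orient_sq [simp]: "orient g i * orient g i = 1"
  by (simp add: orient_def)

lemma orient_sq_left [simp]: "orient g i * (orient g i * a) = a"
  by (simp flip: mult.assoc)

lemma partner_eq_iff: "i \<in> {1..2*g} \<Longrightarrow> j \<in> {1..2*g} \<Longrightarrow> partner g i = j \<longleftrightarrow> partner g j = i"
  by (metis partner_partner)

text \<open>
  The operators \<open>clifford g c i\<close> anticommute for every \<open>c\<close>. For \<open>c = y\<close> they describe
  multiplication by \<open>x\<^sub>i\<close> in the coordinates of the basis \<open>(e\<^sub>S)\<close>, and for \<open>c = - y\<close> they
  produce \<open>e\<^sub>S\<close> from \<open>1\<close>.
\<close>

definition clifford :: "nat \<Rightarrow> 'a::comm_ring_1 \<Rightarrow> nat \<Rightarrow> (nat set \<Rightarrow> 'a) \<Rightarrow> nat set \<Rightarrow> 'a" where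
  "clifford g c i p = (\<lambda>U. wedge i p U + c * orient g i * contract (partner g i) p U)"

lemma clifford_0: "clifford g 0 i p = wedge i p"
  by (simp add: clifford_def)

lemma wedge_add: "wedge i (\<lambda>U. p U + q U) U = wedge i p U + wedge i q U"
  and wedge_scale: "wedge i (\<lambda>U. r * p U) U = r * wedge i p U"
  and contract_add: "contract i (\<lambda>U. p U + q U) U = contract i p U + contract i q U"
  and contract_scale: "contract i (\<lambda>U. r * p U) U = r * contract i p U"
  by (auto simp: wedge_def contract_def algebra_simps)

lemma wedge_sum: "wedge i (\<lambda>U. \<Sum>s\<in>A. f s U) U = (\<Sum>s\<in>A. wedge i (f s) U)"
  and contract_sum: "contract i (\<lambda>U. \<Sum>s\<in>A. f s U) U = (\<Sum>s\<in>A. contract i (f s) U)"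
  by (auto simp: wedge_def contract_def sum_distrib_left)

lemma clifford_scale: "clifford g c i (\<lambda>U. r * p U) U = r * clifford g c i p U"
  by (simp add: clifford_def wedge_scale contract_scale algebra_simps)

lemma clifford_sum: "clifford g c i (\<lambda>U. \<Sum>s\<in>A. f s U) U = (\<Sum>s\<in>A. clifford g c i (f s) U)"
  by (simp add: clifford_def wedge_sum contract_sum sum.distrib sum_distrib_left)

lemma clifford_zero: "clifford g c i (\<lambda>U. 0) U = 0"
  using clifford_scale[of g c i 0 "\<lambda>_. 0" U] by simp

text \<open>Scalar terms arise only when \<open>j\<close> is the partner of \<open>i\<close>, namely
  from \<open>c * orient g i\<close> and \<open>c * orient g j\<close>. They cancel because
  \<open>orient\<close> changes sign under \<open>partner\<close>.\<close>

lemma clifford_anticommute: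
  assumes "i \<in> {1..2*g}" "j \<in> {1..2*g}"
  shows "clifford g c i (clifford g c j p) U = - clifford g c j (clifford g c i p) U"
proof -
  have *: "clifford g c i (clifford g c j p) U = wedge i (wedge j p) U
      + c * orient g j * wedge i (contract (partner g j) p) U
      + c * orient g i * contract (partner g i) (wedge j p) U
      + c * orient g i * (c * orient g j) * contract (partner g i) (contract (partner g j) p) U"
    for i j
    unfolding clifford_def wedge_add contract_add wedge_scale contract_scale
    by (simp add: algebra_simps)
  have "partner g i = j \<Longrightarrow> partner g j = i \<and> orient g j = (- orient g i :: 'a)"
    using assms by auto
  moreover have "partner g i = j \<longleftrightarrow> partner g j = i" using assms by (rule partner_eq_iff)
  ultimately show ?thesis
    unfolding * contract_wedge
      wedge_wedge[of i j] contract_contract[of "partner g i" "partner g j"]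
    by (auto simp: algebra_simps)
qed

text \<open>Anticommutation alone gives only that twice the left side vanishes. The contraction here
  belongs to \<open>partner g i\<close>, which differs from \<open>i\<close>, so the mixed terms
  cancel.\<close>

lemma clifford_same:
  assumes "i \<in> {1..2*g}"
  shows "clifford g c i (clifford g c i p) U = 0"
proof -
  have "clifford g c i (clifford g c i p) U = wedge i (wedge i p) U
      + c * orient g i * wedge i (contract (partner g i) p) U
      + c * orient g i * contract (partner g i) (wedge i p) U
      + c * orient g i * (c * orient g i) * contract (partner g i) (contract (partner g i) p) U"
    unfolding clifford_def wedge_add contract_add wedge_scale contract_scale
    by (simp add: algebra_simps)
  then show ?thesis using assms by (simp add: contract_wedge)
qed

text \<open>Contractions anticommute with one another, so the deformation leaves the relation of
  \<open>contract_wedge\<close> unchanged.\<close>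

lemma contract_clifford:
  "contract j (clifford g c i p) U = (if i = j then p U else 0) - clifford g c i (contract j p) U"
  unfolding clifford_def contract_add contract_scale contract_wedge
  by (simp add: contract_contract[of j] algebra_simps)

section \<open>Monomials and blades\<close>

definition monomial :: "nat set \<Rightarrow> nat set \<Rightarrow> 'a::comm_ring_1" where
  "monomial S = (\<lambda>U. if U = S then 1 else 0)"

lemma wedge_monomial: "wedge i (monomial S) U = (if i \<in> S then 0 else sg i S * monomial (insert i S) U)"
  by (auto simp: wedge_def monomial_def sg_insert)

lemma contract_monomial: "contract i (monomial S) U = (if i \<in> S then sg i S * monomial (S - {i}) U else 0)"
  by (auto simp: contract_def monomial_def sg_remove)

text \<open>For \<open>c = 0\<close> these are the monomials, for \<open>c = - y\<close> the
  elements e_S with a definite choice of sign, and for \<open>c = y\<close> the monomials written in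
  the coordinates of the basis (e_S).\<close>

definition cblade :: "nat \<Rightarrow> 'a::comm_ring_1 \<Rightarrow> nat set \<Rightarrow> nat set \<Rightarrow> 'a" where
  "cblade g c S = foldr (clifford g c) (sorted_list_of_set S) (monomial {})"

lemma cblade_empty [simp]: "cblade g c {} = monomial {}"
  by (simp add: cblade_def)

lemma sorted_list_of_set_insert_min:
  fixes b :: nat
  assumes "finite A" "\<And>a. a \<in> A \<Longrightarrow> b < a"
  shows "sorted_list_of_set (insert b A) = b # sorted_list_of_set A"
proof -
  have "b \<notin> A" using assms(2) by blast
  then show ?thesis using assms
    by (auto simp: sorted_list_of_set.sorted_key_list_of_set_insert intro!: insort_is_Cons less_imp_le)
qed

lemma cblade_insert_min:
  assumes "finite A" "\<And>a. a \<in> A \<Longrightarrow> b < a"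
  shows "cblade g c (insert b A) = clifford g c b (cblade g c A)"
  using assms by (simp only: cblade_def sorted_list_of_set_insert_min foldr.simps o_apply)

text \<open>The operators anticommute and have square zero, so \<open>i\<close> moves to its place
  as in an exterior algebra. The induction peels off the minimum of \<open>S\<close>; only an
  \<open>i\<close> above it has to pass it.\<close>

lemma clifford_cblade:
  assumes "S \<subseteq> {1..2*g}" "i \<in> {1..2*g}"
  shows "clifford g c i (cblade g c S) U = (if i \<in> S then 0 else sg i S * cblade g c (insert i S) U)"
proof -
  have "finite S" using assms(1) finite_subset by blast
  then show ?thesis using assms(1)
  proof (induction S arbitrary: U rule: finite_linorder_min_induct)
    case empty
    then show ?case using cblade_insert_min[of "{}" i g c] by (simp add: sg_def)
  next
    case (insert b A)
    have b: "b \<in> {1..2*g}" and A: "A \<subseteq> {1..2*g}" and bA: "b \<notin> A" using insert by auto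
    have ins: "cblade g c (insert b A) = clifford g c b (cblade g c A)"
      using insert by (intro cblade_insert_min) auto
    consider "i < b" | "i = b" | "b < i" by linarith
    then show ?case
    proof cases
      case 1
      then have lt: "a \<in> insert b A \<Longrightarrow> i < a" for a using insert(2) by fastforce
      then have "cblade g c (insert i (insert b A)) = clifford g c i (cblade g c (insert b A))"
        using insert by (intro cblade_insert_min) auto
      moreover have "sg i (insert b A) = (1::'a)" using lt by (intro sg_below) (simp add: less_imp_le)
      ultimately show ?thesis using lt by auto
    next
      case 2
      then show ?thesis by (simp add: ins clifford_same[OF b])
    next
      case 3
      have "clifford g c i (cblade g c (insert b A)) U
          = - clifford g c b (clifford g c i (cblade g c A)) U"
        by (simp add: ins clifford_anticommute[OF assms(2) b])
      also have "\<dots> = - clifford g c b (\<lambda>U. if i \<in> A then 0 else sg i A * cblade g c (insert i A) U) U"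
        using insert.IH[OF A] by presburger
      also have "\<dots> = (if i \<in> A then 0 else - (sg i A * clifford g c b (cblade g c (insert i A)) U))"
        by (simp add: clifford_scale clifford_zero)
      also have "clifford g c b (cblade g c (insert i A)) = cblade g c (insert b (insert i A))"
        using insert 3 by (intro cblade_insert_min[symmetric]) auto
      finally show ?thesis using 3 bA by (simp add: sg_insert insert_commute)
    qed
  qed
qed

text \<open>The relation \<open>contract_clifford\<close> has no scalar term depending on
  \<open>c\<close>, so contraction acts on blades as on monomials.\<close>

lemma contract_cblade:
  assumes "finite S"
  shows "contract j (cblade g c S) U = (if j \<in> S then sg j S * cblade g c (S - {j}) U else 0)"
  using assms
proof (induction S arbitrary: U rule: finite_linorder_min_induct)
  case empty
  then show ?case by (simp add: contract_monomial)
next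
  case (insert b A)
  have bA: "b \<notin> A" using insert by auto
  have "cblade g c (insert b A) = clifford g c b (cblade g c A)"
    using insert by (intro cblade_insert_min) auto
  then have "contract j (cblade g c (insert b A)) U
     = (if b = j then cblade g c A U else 0) - clifford g c b (contract j (cblade g c A)) U"
    by (simp add: contract_clifford)
  also have "clifford g c b (contract j (cblade g c A)) U
     = clifford g c b (\<lambda>U. if j \<in> A then sg j A * cblade g c (A - {j}) U else 0) U"
    using insert.IH by presburger
  also have "\<dots> = (if j \<in> A then sg j A * clifford g c b (cblade g c (A - {j})) U else 0)"
    by (simp add: clifford_scale clifford_zero)
  also have "clifford g c b (cblade g c (A - {j})) = cblade g c (insert b (A - {j}))"
    using insert by (intro cblade_insert_min[symmetric]) auto
  finally show ?case using bA insert(2)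
    by (auto simp: sg_insert insert_Diff_if sg_below less_imp_le)
qed

text \<open>
  Changes of coordinates, which add in \<open>c\<close>: for \<open>c = y\<close> from monomials to the basis \<open>(e\<^sub>S)\<close>,
  for \<open>c = - y\<close> back.
\<close>

definition quantize :: "nat \<Rightarrow> 'a::comm_ring_1 \<Rightarrow> (nat set \<Rightarrow> 'a) \<Rightarrow> nat set \<Rightarrow> 'a" where
  "quantize g c p = (\<lambda>U. \<Sum>S\<in>Pow {1..2*g}. p S * cblade g c S U)"

lemma sum_Pow_insert:
  assumes "finite N" "i \<in> N"
  shows "(\<Sum>S\<in>Pow N. if i \<in> S then f S else 0) = (\<Sum>S\<in>Pow N. if i \<in> S then 0 else f (insert i S))"
proof -
  have "(\<Sum>S\<in>Pow N. if i \<in> S then f S else 0) = (\<Sum>S\<in>{S\<in>Pow N. i \<in> S}. f S)"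
    using assms by (simp add: sum.If_cases Int_def)
  also have "\<dots> = (\<Sum>S\<in>{S\<in>Pow N. i \<notin> S}. f (insert i S))"
    using assms by (intro sum.reindex_bij_witness[of _ "insert i" "\<lambda>S. S - {i}"]) (auto simp: insert_absorb)
  also have "\<dots> = (\<Sum>S\<in>Pow N. if i \<in> S then 0 else f (insert i S))"
    using assms by (simp add: sum.If_cases Int_def)
  finally show ?thesis .
qed

lemma sum_Pow_remove:
  assumes "finite N" "i \<in> N"
  shows "(\<Sum>S\<in>Pow N. if i \<in> S then 0 else f S) = (\<Sum>S\<in>Pow N. if i \<in> S then f (S - {i}) else 0)"
  unfolding sum_Pow_insert[OF assms] by (intro sum.cong) auto

text \<open>Blades multiply under \<open>clifford\<close> as monomials do under
  \<open>wedge\<close>, so the change of coordinates intertwines the two operators.\<close>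

lemma quantize_wedge:
  assumes "i \<in> {1..2*g}"
  shows "quantize g c (wedge i p) = clifford g c i (quantize g c p)"
proof
  fix U
  have "quantize g c (wedge i p) U
     = (\<Sum>S\<in>Pow {1..2*g}. if i \<in> S then sg i S * p (S - {i}) * cblade g c S U else 0)"
    unfolding quantize_def by (intro sum.cong) (auto simp: wedge_def)
  also have "\<dots> = (\<Sum>S\<in>Pow {1..2*g}. if i \<in> S then 0 else sg i S * p S * cblade g c (insert i S) U)"
    using assms by (subst sum_Pow_insert) (auto intro!: sum.cong simp: sg_insert)
  also have "\<dots> = (\<Sum>S\<in>Pow {1..2*g}. p S * clifford g c i (cblade g c S) U)"
    using assms by (intro sum.cong) (auto simp: clifford_cblade algebra_simps)
  also have "\<dots> = clifford g c i (quantize g c p) U"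
    unfolding quantize_def clifford_sum clifford_scale ..
  finally show "quantize g c (wedge i p) U = clifford g c i (quantize g c p) U" .
qed

lemma quantize_contract:
  assumes "i \<in> {1..2*g}"
  shows "quantize g c (contract i p) = contract i (quantize g c p)"
proof
  fix U
  have "quantize g c (contract i p) U
     = (\<Sum>S\<in>Pow {1..2*g}. if i \<in> S then 0 else sg i S * p (insert i S) * cblade g c S U)"
    unfolding quantize_def by (intro sum.cong) (auto simp: contract_def)
  also have "\<dots> = (\<Sum>S\<in>Pow {1..2*g}. if i \<in> S then sg i S * p S * cblade g c (S - {i}) U else 0)"
    using assms by (subst sum_Pow_remove) (auto intro!: sum.cong simp: sg_remove insert_absorb)
  also have "\<dots> = (\<Sum>S\<in>Pow {1..2*g}. p S * contract i (cblade g c S) U)"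
    by (intro sum.cong) (auto simp: contract_cblade finite_subset algebra_simps)
  also have "\<dots> = contract i (quantize g c p) U"
    unfolding quantize_def contract_sum contract_scale ..
  finally show "quantize g c (contract i p) U = contract i (quantize g c p) U" .
qed

lemma quantize_add: "quantize g c (\<lambda>U. p U + q U) U = quantize g c p U + quantize g c q U"
  and quantize_scale: "quantize g c (\<lambda>U. r * p U) U = r * quantize g c p U"
  by (simp_all add: quantize_def algebra_simps sum.distrib sum_distrib_left)

lemma quantize_sum: "quantize g c (\<lambda>U. \<Sum>s\<in>A. f s U) U = (\<Sum>s\<in>A. quantize g c (f s) U)"
  unfolding quantize_def by (subst sum.swap) (simp add: sum_distrib_right)

text \<open>\<open>quantize\<close> turns \<open>wedge\<close> into the operator with parameter
  \<open>c\<close> and commutes with contractions, so the contraction parts add up to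
  \<open>c + d\<close>.\<close>

lemma quantize_clifford:
  assumes "i \<in> {1..2*g}"
  shows "quantize g c (clifford g d i p) = clifford g (c + d) i (quantize g c p)"
proof
  fix U
  show "quantize g c (clifford g d i p) U = clifford g (c + d) i (quantize g c p) U"
    using assms
    by (simp only: clifford_def[of g d] quantize_add quantize_scale quantize_wedge
        quantize_contract partner_in) (simp add: clifford_def algebra_simps)
qed

lemma quantize_monomial:
  assumes "S \<subseteq> {1..2*g}"
  shows "quantize g c (monomial S) = cblade g c S"
proof
  fix U
  have "quantize g c (monomial S) U = (\<Sum>T\<in>Pow {1..2*g}. if T = S then cblade g c S U else 0)"
    unfolding quantize_def by (intro sum.cong) (auto simp: monomial_def)
  also have "\<dots> = cblade g c S U" using assms by simp
  finally show "quantize g c (monomial S) U = cblade g c S U" .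
qed

lemma quantize_cblade:
  assumes "S \<subseteq> {1..2*g}"
  shows "quantize g c (cblade g d S) = cblade g (c + d) S"
proof -
  have "finite S" using assms finite_subset by blast
  then show ?thesis using assms
  proof (induction S rule: finite_linorder_min_induct)
    case empty
    show ?case using quantize_monomial[of "{}" g c] by simp
  next
    case (insert b A)
    then show ?case by (simp add: cblade_insert_min quantize_clifford)
  qed
qed

lemma cblade_0: "finite S \<Longrightarrow> cblade g 0 S = monomial S"
proof (induction S rule: finite_linorder_min_induct)
  case (insert b A)
  then have "cblade g 0 (insert b A) = (wedge b (monomial A) :: _ \<Rightarrow> 'a)"
    by (simp add: cblade_insert_min clifford_0)
  moreover have "b \<notin> A" "sg b A = (1::'a)" using insert by (auto intro: sg_below less_imp_le)
  ultimately show ?case by (auto simp: wedge_monomial)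
qed simp

lemma quantize_0:
  assumes "\<And>S. \<not> S \<subseteq> {1..2*g} \<Longrightarrow> p S = 0"
  shows "quantize g 0 p = p"
proof
  fix U
  have "quantize g 0 p U = (\<Sum>S\<in>Pow {1..2*g}. if S = U then p U else 0)"
    unfolding quantize_def by (intro sum.cong) (auto simp: cblade_0 finite_subset monomial_def)
  also have "\<dots> = p U" using assms by auto
  finally show "quantize g 0 p U = p U" .
qed

text \<open>In view of \<open>quantize_0\<close>, this makes \<open>quantize g (- c)\<close> the
  inverse of \<open>quantize g c\<close> on families supported on subsets of
  \<open>{1..2*g}\<close>.\<close>

lemma quantize_quantize: "quantize g c (quantize g d p) = quantize g (c + d) p"
proof
  fix U
  have "quantize g c (quantize g d p) U
      = (\<Sum>S\<in>Pow {1..2*g}. p S * quantize g c (cblade g d S) U)"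
    by (simp only: quantize_def[of g d p] quantize_sum quantize_scale)
  also have "\<dots> = quantize g (c + d) p U"
    unfolding quantize_def[of g "c + d"] by (intro sum.cong) (auto simp: quantize_cblade)
  finally show "quantize g c (quantize g d p) U = quantize g (c + d) p U" .
qed

text \<open>The grading automorphism, by which left and right multiplication by an odd variable
  differ.\<close>

definition parity :: "(nat set \<Rightarrow> 'a) \<Rightarrow> nat set \<Rightarrow> 'a::comm_ring_1" where
  "parity p = (\<lambda>U. (-1) ^ card U * p U)"

text \<open>Both \<open>wedge\<close> and \<open>contract\<close> change the cardinality of the
  index by one. Finiteness of \<open>U\<close> matters because \<open>card\<close> is 0 on infinite
  sets.\<close>

lemma parity_clifford:
  assumes "finite U"
  shows "parity (clifford g c i p) U = - clifford g c i (parity p) U"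
proof -
  have "i \<in> U \<Longrightarrow> (-1) ^ card U = - ((-1) ^ card (U - {i}) :: 'a)"
    using assms by (metis card.remove power_Suc mult_minus1)
  then show ?thesis using assms
    by (auto simp: parity_def clifford_def wedge_def contract_def algebra_simps)
qed

lemma clifford_cong_finite:
  assumes "\<And>V. finite V \<Longrightarrow> p V = q V" "finite U"
  shows "clifford g c i p U = clifford g c i q U"
  using assms by (simp add: clifford_def wedge_def contract_def)

lemma parity_cblade:
  assumes "finite S" "finite U"
  shows "parity (cblade g c S) U = (-1) ^ card S * cblade g c S U"
  using assms
proof (induction S arbitrary: U rule: finite_linorder_min_induct)
  case (insert b A)
  then have "parity (cblade g c (insert b A)) U = - clifford g c b (parity (cblade g c A)) U"
    by (simp add: cblade_insert_min parity_clifford)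
  also have "\<dots> = - clifford g c b (\<lambda>U. (-1) ^ card A * cblade g c A U) U"
    using insert by (subst clifford_cong_finite[where q = "\<lambda>U. (-1) ^ card A * cblade g c A U"]) auto
  finally show ?case using insert by (auto simp: clifford_scale cblade_insert_min)
qed (simp add: parity_def monomial_def)

lemma quantize_parity:
  assumes "finite U"
  shows "quantize g c (parity p) U = parity (quantize g c p) U"
proof -
  have "quantize g c (parity p) U = (\<Sum>S\<in>Pow {1..2*g}. p S * parity (cblade g c S) U)"
    unfolding quantize_def
  proof (intro sum.cong refl)
    fix S assume "S \<in> Pow {1..2*g}"
    then have "finite S" using finite_subset by blast
    then show "parity p S * cblade g c S U = p S * parity (cblade g c S) U"
      by (simp only: parity_cblade[OF _ assms]) (simp add: parity_def)
  qed
  also have "\<dots> = parity (quantize g c p) U"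
    by (simp add: parity_def quantize_def sum_distrib_left algebra_simps)
  finally show ?thesis .
qed

subsection \<open>The free graded commutative algebra and its ideals\<close>

lemma free_gca_carrier: "p \<in> carrier (free_gca g) \<longleftrightarrow> (\<forall>S. \<not> S \<subseteq> {1..2*g} \<longrightarrow> p S = 0)"
  and free_gca_mult: "p \<otimes>\<^bsub>free_gca g\<^esub> q =
     (\<lambda>U. \<Sum>S\<in>Pow U. smult (shuffle_sign S (U - S)) (p S * q (U - S)))"
  and free_gca_one: "\<one>\<^bsub>free_gca g\<^esub> = monomial {}"
  and free_gca_zero: "\<zero>\<^bsub>free_gca g\<^esub> = (\<lambda>S. 0)"
  and free_gca_add: "p \<oplus>\<^bsub>free_gca g\<^esub> q = (\<lambda>S. p S + q S)"
  by (simp_all add: free_gca_def monomial_def)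

section \<open>Shuffle signs\<close>

lemma shuffle_sign_empty [simp]: "shuffle_sign {} T = 1" "shuffle_sign S {} = 1"
  by (simp_all add: shuffle_sign_def)

lemma finite_inversions:
  "finite S \<Longrightarrow> finite T \<Longrightarrow> finite {(s, t). s \<in> S \<and> t \<in> T \<and> (t::nat) < s}"
  by (rule finite_subset[of _ "S \<times> T"]) auto

lemma shuffle_sign_Un_left:
  assumes "finite A" "finite B" "finite C" "A \<inter> B = {}"
  shows "shuffle_sign (A \<union> B) C = shuffle_sign A C * shuffle_sign B C"
proof -
  have "{(s, t). s \<in> A \<union> B \<and> t \<in> C \<and> t < s}
      = {(s, t). s \<in> A \<and> t \<in> C \<and> t < s} \<union> {(s, t). s \<in> B \<and> t \<in> C \<and> t < s}" by auto
  then have "card {(s, t). s \<in> A \<union> B \<and> t \<in> C \<and> t < s}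
      = card {(s, t). s \<in> A \<and> t \<in> C \<and> t < s} + card {(s, t). s \<in> B \<and> t \<in> C \<and> t < s}"
    using assms by (auto intro!: card_Un_disjoint finite_inversions)
  then show ?thesis unfolding shuffle_sign_def by (simp only: power_add)
qed

lemma shuffle_sign_Un_right:
  assumes "finite A" "finite B" "finite C" "B \<inter> C = {}"
  shows "shuffle_sign A (B \<union> C) = shuffle_sign A B * shuffle_sign A C"
proof -
  have "{(s, t). s \<in> A \<and> t \<in> B \<union> C \<and> t < s}
      = {(s, t). s \<in> A \<and> t \<in> B \<and> t < s} \<union> {(s, t). s \<in> A \<and> t \<in> C \<and> t < s}" by auto
  then have "card {(s, t). s \<in> A \<and> t \<in> B \<union> C \<and> t < s}
      = card {(s, t). s \<in> A \<and> t \<in> B \<and> t < s} + card {(s, t). s \<in> A \<and> t \<in> C \<and> t < s}"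
    using assms by (auto intro!: card_Un_disjoint finite_inversions)
  then show ?thesis unfolding shuffle_sign_def by (simp only: power_add)
qed

lemma shuffle_sign_singleton_left: "shuffle_sign {i} T = sg i T"
proof -
  have "{(s, t). s \<in> {i} \<and> t \<in> T \<and> t < s} = Pair i ` {t \<in> T. t < i}" by auto
  then show ?thesis by (simp add: shuffle_sign_def sg_def card_image inj_on_def)
qed

text \<open>\<open>shuffle_sign\<close> counts the elements above \<open>i\<close>,
  \<open>sg\<close> those below; as \<open>i\<close> is not in \<open>S\<close>, the two counts add
  up to \<open>card S\<close>.\<close>

lemma shuffle_sign_singleton_right:
  assumes "finite S" "i \<notin> S"
  shows "shuffle_sign S {i} = (-1) ^ card S * sg i S"
proof -
  have "{(s, t). s \<in> S \<and> t \<in> {i} \<and> t < s} = (\<lambda>s. (s, i)) ` {s \<in> S. i < s}" by auto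
  then have 1: "shuffle_sign S {i} = (-1) ^ card {s \<in> S. i < s}"
    by (simp add: shuffle_sign_def card_image inj_on_def)
  have "S = {s \<in> S. s < i} \<union> {s \<in> S. i < s}" using assms(2) nat_neq_iff by auto
  then have "card S = card {s \<in> S. s < i} + card {s \<in> S. i < s}"
    using assms(1) by (metis (no_types, lifting) card_Un_disjoint finite_Un disjoint_iff mem_Collect_eq
        order_less_asym)
  then show ?thesis unfolding 1 sg_def
    by (simp add: power_add mult.left_commute flip: power_mult_distrib)
qed

text \<open>Passes from the rational signs of \<open>free_gca\<close> to the polynomial signs of
  \<open>wedge\<close>; the two occurrences of \<open>sg\<close> have different types.\<close>

lemma smult_sg: "smult (sg i S) p = sg i S * p"
  by (cases "even (card {t \<in> S. t < i})") (simp_all add: sg_def)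

lemma smult_power_minus_one: "smult ((-1) ^ k) (p :: 'a::comm_ring_1 poly) = (-1) ^ k * p"
  by (cases "even k") simp_all

lemma smult_sum_right: "smult c (\<Sum>s\<in>A. f s) = (\<Sum>s\<in>A. smult c (f s))"
  by (induction A rule: infinite_finite_induct) (simp_all add: smult_add_right)

section \<open>The ring axioms\<close>

lemma free_gca_mult_closed:
  assumes "p \<in> carrier (free_gca g)" "q \<in> carrier (free_gca g)"
  shows "p \<otimes>\<^bsub>free_gca g\<^esub> q \<in> carrier (free_gca g)"
  unfolding free_gca_carrier free_gca_mult
proof (intro allI impI sum.neutral ballI)
  fix U S assume "\<not> U \<subseteq> {1..2*g}" "S \<in> Pow U"
  then have "\<not> S \<subseteq> {1..2*g} \<or> \<not> U - S \<subseteq> {1..2*g}" by blast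
  then have "p S = 0 \<or> q (U - S) = 0" using assms unfolding free_gca_carrier by blast
  then show "smult (shuffle_sign S (U - S)) (p S * q (U - S)) = 0" by auto
qed

text \<open>Both sides run over the ordered partitions of \<open>U\<close> into three sets, weighted
  with the product of the three pairwise shuffle signs.\<close>

lemma free_gca_assoc:
  "(p \<otimes>\<^bsub>free_gca g\<^esub> q) \<otimes>\<^bsub>free_gca g\<^esub> r = p \<otimes>\<^bsub>free_gca g\<^esub> (q \<otimes>\<^bsub>free_gca g\<^esub> r)"
proof
  fix U
  show "((p \<otimes>\<^bsub>free_gca g\<^esub> q) \<otimes>\<^bsub>free_gca g\<^esub> r) U = (p \<otimes>\<^bsub>free_gca g\<^esub> (q \<otimes>\<^bsub>free_gca g\<^esub> r)) U"
  proof (cases "finite U")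
    case False
    \<comment> \<open>Then \<open>Pow U\<close> is infinite and the sums over it are 0 by
      convention.\<close>
    then show ?thesis by (simp add: free_gca_mult)
  next
    case True
    define f where "f R T V = smult (shuffle_sign R T * shuffle_sign R V * shuffle_sign T V)
      (p R * q T * r V)" for R T V
    have fin: "S \<subseteq> U \<Longrightarrow> finite S" for S using True finite_subset by blast
    have "((p \<otimes>\<^bsub>free_gca g\<^esub> q) \<otimes>\<^bsub>free_gca g\<^esub> r) U
        = (\<Sum>S\<in>Pow U. \<Sum>R\<in>Pow S. f R (S - R) (U - S))"
      unfolding free_gca_mult sum_distrib_right smult_sum_right
    proof (intro sum.cong refl)
      fix S R assume "S \<in> Pow U" "R \<in> Pow S"
      then have "shuffle_sign S (U - S) = shuffle_sign R (U - S) * shuffle_sign (S - R) (U - S)"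
        using shuffle_sign_Un_left[of R "S - R" "U - S"] fin True
        by (simp add: Un_absorb1 finite_subset)
      then show "smult (shuffle_sign S (U - S))
          (smult (shuffle_sign R (S - R)) (p R * q (S - R)) * r (U - S)) = f R (S - R) (U - S)"
        by (simp add: f_def mult_ac)
    qed
    also have "\<dots> = (\<Sum>(S, R)\<in>(SIGMA S:Pow U. Pow S). f R (S - R) (U - S))"
      using True fin by (subst sum.Sigma) auto
    \<comment> \<open>\<open>S\<close> is the union of the first two parts; it is replaced by the
      second part \<open>T = S - R\<close>.\<close>
    also have "\<dots> = (\<Sum>(R, T)\<in>(SIGMA R:Pow U. Pow (U - R)). f R T (U - R - T))"
      by (intro sum.reindex_bij_witness[of _ "\<lambda>(R, T). (R \<union> T, R)" "\<lambda>(S, R). (R, S - R)"])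
        (auto simp: Diff_Diff_Int intro!: arg_cong3[where f = f] split: prod.splits)
    also have "\<dots> = (\<Sum>R\<in>Pow U. \<Sum>T\<in>Pow (U - R). f R T (U - R - T))"
      using True fin by (subst sum.Sigma) auto
    also have "\<dots> = (p \<otimes>\<^bsub>free_gca g\<^esub> (q \<otimes>\<^bsub>free_gca g\<^esub> r)) U"
      unfolding free_gca_mult sum_distrib_left smult_sum_right
    proof (intro sum.cong refl)
      fix R T assume "R \<in> Pow U" "T \<in> Pow (U - R)"
      then have "shuffle_sign R (U - R) = shuffle_sign R T * shuffle_sign R (U - R - T)"
        using shuffle_sign_Un_right[of R T "U - R - T"] fin True
        by (simp add: Un_absorb1 finite_subset)
      then show "f R T (U - R - T) = smult (shuffle_sign R (U - R))
          (p R * smult (shuffle_sign T (U - R - T)) (q T * r (U - R - T)))"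
        by (simp add: f_def mult_ac)
    qed
    finally show ?thesis .
  qed
qed

lemma monomial_mult:
  assumes "finite U"
  shows "(monomial T \<otimes>\<^bsub>free_gca g\<^esub> q) U
    = (if T \<subseteq> U then smult (shuffle_sign T (U - T)) (q (U - T)) else 0)"
proof -
  have "(monomial T \<otimes>\<^bsub>free_gca g\<^esub> q) U
     = (\<Sum>S\<in>Pow U. if S = T then smult (shuffle_sign T (U - T)) (q (U - T)) else 0)"
    unfolding free_gca_mult by (intro sum.cong) (auto simp: monomial_def)
  then show ?thesis using assms by simp
qed

lemma mult_monomial:
  assumes "finite U"
  shows "(p \<otimes>\<^bsub>free_gca g\<^esub> monomial T) U
    = (if T \<subseteq> U then smult (shuffle_sign (U - T) T) (p (U - T)) else 0)"
proof -
  have "(p \<otimes>\<^bsub>free_gca g\<^esub> monomial T) U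
     = (\<Sum>S\<in>Pow U. if S = U - T then (if T \<subseteq> U then smult (shuffle_sign (U - T) T) (p (U - T)) else 0) else 0)"
    unfolding free_gca_mult by (intro sum.cong) (auto simp: monomial_def double_diff)
  then show ?thesis using assms by simp
qed

lemma carrier_infinite: "p \<in> carrier (free_gca g) \<Longrightarrow> infinite U \<Longrightarrow> p U = 0"
  unfolding free_gca_carrier using finite_subset by blast

lemma free_gca_one_mult:
  assumes "p \<in> carrier (free_gca g)"
  shows "monomial {} \<otimes>\<^bsub>free_gca g\<^esub> p = p" "p \<otimes>\<^bsub>free_gca g\<^esub> monomial {} = p"
proof -
  have "(monomial {} \<otimes>\<^bsub>free_gca g\<^esub> p) U = p U \<and> (p \<otimes>\<^bsub>free_gca g\<^esub> monomial {}) U = p U" for U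
  proof (cases "finite U")
    case True
    then show ?thesis by (simp add: monomial_mult mult_monomial)
  next
    case False
    then show ?thesis using carrier_infinite[OF assms] by (simp add: free_gca_mult)
  qed
  then show "monomial {} \<otimes>\<^bsub>free_gca g\<^esub> p = p" "p \<otimes>\<^bsub>free_gca g\<^esub> monomial {} = p" by auto
qed

lemma free_gca_ring: "ring (free_gca g)"
proof (rule ringI)
  show "abelian_group (free_gca g)"
  proof (rule abelian_groupI)
    fix x assume "x \<in> carrier (free_gca g)"
    then show "\<exists>y\<in>carrier (free_gca g). y \<oplus>\<^bsub>free_gca g\<^esub> x = \<zero>\<^bsub>free_gca g\<^esub>"
      by (intro bexI[of _ "\<lambda>S. - x S"]) (auto simp: free_gca_carrier free_gca_add free_gca_zero)
  qed (auto simp: free_gca_carrier free_gca_add free_gca_zero algebra_simps)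
  show "monoid (free_gca g)"
    by (rule monoidI) (simp_all only: free_gca_mult_closed free_gca_assoc free_gca_one
        free_gca_one_mult, auto simp: free_gca_carrier monomial_def)
qed (auto simp: free_gca_add free_gca_mult algebra_simps smult_add_right sum.distrib)

lemma free_gca_a_inv:
  assumes "p \<in> carrier (free_gca g)"
  shows "\<ominus>\<^bsub>free_gca g\<^esub> p = (\<lambda>S. - p S)"
proof -
  interpret ring "free_gca g" by (rule free_gca_ring)
  show ?thesis
    using assms by (intro minus_equality) (auto simp: free_gca_carrier free_gca_add free_gca_zero)
qed

lemma free_gca_a_minus:
  assumes "q \<in> carrier (free_gca g)"
  shows "p \<ominus>\<^bsub>free_gca g\<^esub> q = (\<lambda>S. p S - q S)"
  using assms by (simp add: a_minus_def free_gca_a_inv free_gca_add)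

section \<open>Multiplication by monomials and scalars\<close>

lemma monomial_carrier: "S \<subseteq> {1..2*g} \<Longrightarrow> monomial S \<in> carrier (free_gca g)"
  by (auto simp: free_gca_carrier monomial_def)

lemma monomial_singleton_mult:
  assumes "q \<in> carrier (free_gca g)"
  shows "monomial {i} \<otimes>\<^bsub>free_gca g\<^esub> q = wedge i q"
proof
  fix U
  show "(monomial {i} \<otimes>\<^bsub>free_gca g\<^esub> q) U = wedge i q U"
  proof (cases "finite U")
    case True
    then show ?thesis
      by (auto simp: monomial_mult shuffle_sign_singleton_left smult_sg wedge_def sg_remove)
  next
    case False
    then show ?thesis using carrier_infinite[OF assms, of "U - {i}"] by (simp add: free_gca_mult wedge_def)
  qed
qed

lemma mult_monomial_singleton:
  assumes "p \<in> carrier (free_gca g)"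
  shows "p \<otimes>\<^bsub>free_gca g\<^esub> monomial {i} = wedge i (parity p)"
proof
  fix U
  show "(p \<otimes>\<^bsub>free_gca g\<^esub> monomial {i}) U = wedge i (parity p) U"
  proof (cases "finite U")
    case True
    then show ?thesis
      by (auto simp: mult_monomial shuffle_sign_singleton_right smult_sg smult_power_minus_one
          wedge_def sg_remove parity_def mult_ac simp flip: smult_smult)
  next
    case False
    then show ?thesis using carrier_infinite[OF assms, of "U - {i}"]
      by (simp add: free_gca_mult wedge_def parity_def)
  qed
qed

text \<open>Coefficients in \<rat>[y] are central, so multiplication by any element is a combination
  of multiplications by monomials.\<close>

lemma mult_expand_left:
  assumes "p \<in> carrier (free_gca g)"
  shows "p \<otimes>\<^bsub>free_gca g\<^esub> q = (\<lambda>U. \<Sum>S\<in>Pow {1..2*g}. p S * (monomial S \<otimes>\<^bsub>free_gca g\<^esub> q) U)"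
proof
  fix U
  show "(p \<otimes>\<^bsub>free_gca g\<^esub> q) U = (\<Sum>S\<in>Pow {1..2*g}. p S * (monomial S \<otimes>\<^bsub>free_gca g\<^esub> q) U)"
  proof (cases "finite U")
    case True
    have "(\<Sum>S\<in>Pow {1..2*g}. p S * (monomial S \<otimes>\<^bsub>free_gca g\<^esub> q) U)
       = (\<Sum>S\<in>Pow {1..2*g} \<inter> Pow U. smult (shuffle_sign S (U - S)) (p S * q (U - S)))"
      using True by (intro sum.mono_neutral_cong_right) (auto simp: monomial_mult)
    also have "\<dots> = (p \<otimes>\<^bsub>free_gca g\<^esub> q) U"
      unfolding free_gca_mult using True assms
      by (intro sum.mono_neutral_left) (auto simp: free_gca_carrier)
    finally show ?thesis ..
  next
    case False
    then show ?thesis by (simp add: free_gca_mult)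
  qed
qed

lemma mult_expand_right:
  assumes "q \<in> carrier (free_gca g)"
  shows "p \<otimes>\<^bsub>free_gca g\<^esub> q = (\<lambda>U. \<Sum>T\<in>Pow {1..2*g}. q T * (p \<otimes>\<^bsub>free_gca g\<^esub> monomial T) U)"
proof
  fix U
  show "(p \<otimes>\<^bsub>free_gca g\<^esub> q) U = (\<Sum>T\<in>Pow {1..2*g}. q T * (p \<otimes>\<^bsub>free_gca g\<^esub> monomial T) U)"
  proof (cases "finite U")
    case True
    have "(\<Sum>T\<in>Pow {1..2*g}. q T * (p \<otimes>\<^bsub>free_gca g\<^esub> monomial T) U)
       = (\<Sum>T\<in>Pow {1..2*g} \<inter> Pow U. smult (shuffle_sign (U - T) T) (p (U - T) * q T))"
      using True by (intro sum.mono_neutral_cong_right) (auto simp: mult_monomial mult_ac)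
    also have "\<dots> = (\<Sum>T\<in>Pow U. smult (shuffle_sign (U - T) T) (p (U - T) * q T))"
      using True assms by (intro sum.mono_neutral_left) (auto simp: free_gca_carrier)
    also have "\<dots> = (p \<otimes>\<^bsub>free_gca g\<^esub> q) U"
      unfolding free_gca_mult
      by (intro sum.reindex_bij_witness[of _ "\<lambda>S. U - S" "\<lambda>S. U - S"]) (auto simp: double_diff)
    finally show ?thesis ..
  next
    case False
    then show ?thesis by (simp add: free_gca_mult)
  qed
qed

lemma scalar_carrier: "(\<lambda>U. r * monomial {} U) \<in> carrier (free_gca g)"
  by (auto simp: free_gca_carrier monomial_def)

lemma scalar_mult:
  assumes "p \<in> carrier (free_gca g)"
  shows "(\<lambda>U. r * monomial {} U) \<otimes>\<^bsub>free_gca g\<^esub> p = (\<lambda>U. r * p U)"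
    and "p \<otimes>\<^bsub>free_gca g\<^esub> (\<lambda>U. r * monomial {} U) = (\<lambda>U. r * p U)"
proof -
  have "((\<lambda>U. r * monomial {} U) \<otimes>\<^bsub>free_gca g\<^esub> p) U = r * (monomial {} \<otimes>\<^bsub>free_gca g\<^esub> p) U"
    "(p \<otimes>\<^bsub>free_gca g\<^esub> (\<lambda>U. r * monomial {} U)) U = r * (p \<otimes>\<^bsub>free_gca g\<^esub> monomial {}) U" for U
    unfolding free_gca_mult by (simp_all add: sum_distrib_left mult_ac)
  then show "(\<lambda>U. r * monomial {} U) \<otimes>\<^bsub>free_gca g\<^esub> p = (\<lambda>U. r * p U)"
    "p \<otimes>\<^bsub>free_gca g\<^esub> (\<lambda>U. r * monomial {} U) = (\<lambda>U. r * p U)"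
    by (auto simp: free_gca_one_mult assms)
qed

text \<open>
  Right multiplication by an odd variable is left multiplication preceded by \<open>parity\<close>, so
  these closure conditions give two-sided ideals.
\<close>

definition gca_stable :: "nat \<Rightarrow> (nat set \<Rightarrow> rat poly) set \<Rightarrow> bool" where
  "gca_stable g C \<longleftrightarrow> C \<subseteq> carrier (free_gca g) \<and> (\<lambda>_. 0) \<in> C
     \<and> (\<forall>p\<in>C. \<forall>q\<in>C. (\<lambda>U. p U + q U) \<in> C) \<and> (\<forall>r. \<forall>p\<in>C. (\<lambda>U. r * p U) \<in> C)
     \<and> (\<forall>i\<in>{1..2*g}. \<forall>p\<in>C. wedge i p \<in> C) \<and> (\<forall>p\<in>C. parity p \<in> C)"

lemma gca_stableD:
  assumes "gca_stable g C" "p \<in> C"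
  shows "p \<in> carrier (free_gca g)" "q \<in> C \<Longrightarrow> (\<lambda>U. p U + q U) \<in> C" "(\<lambda>U. r * p U) \<in> C"
    "i \<in> {1..2*g} \<Longrightarrow> wedge i p \<in> C" "parity p \<in> C"
  using assms unfolding gca_stable_def by (fastforce, simp_all)

lemma gca_stable_sum:
  assumes "gca_stable g C" "finite A" "\<And>s. s \<in> A \<Longrightarrow> f s \<in> C"
  shows "(\<lambda>U. \<Sum>s\<in>A. r s * f s U) \<in> C"
  using assms(2,3)
proof (induction A rule: finite_induct)
  case empty
  then show ?case using assms(1) by (simp add: gca_stable_def)
next
  case (insert x F)
  then have "(\<lambda>U. r x * f x U) \<in> C" "(\<lambda>U. \<Sum>s\<in>F. r s * f s U) \<in> C"
    by (auto intro: gca_stableD[OF assms(1)])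
  from gca_stableD(2)[OF assms(1) this] show ?case using insert by simp
qed

lemma monomial_insert_min:
  assumes "finite A" "\<And>a. a \<in> A \<Longrightarrow> b < a" "insert b A \<subseteq> {1..2*g}"
  shows "monomial (insert b A) = monomial {b} \<otimes>\<^bsub>free_gca g\<^esub> monomial A"
proof -
  have "b \<notin> A" "sg b A = (1::rat poly)" using assms by (auto intro: sg_below less_imp_le)
  then show ?thesis using assms(3)
    by (subst monomial_singleton_mult) (auto simp: monomial_carrier wedge_monomial)
qed

text \<open>By \<open>mult_expand_left\<close> and \<open>mult_expand_right\<close> only monomials
  matter, and these are products of odd variables. On the left a variable acts by
  \<open>wedge\<close>, on the right by \<open>wedge\<close> after \<open>parity\<close>.\<close>

lemma gca_stable_ideal:
  assumes C: "gca_stable g C"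
  shows "ideal C (free_gca g)"
proof (rule idealI)
  show ring: "ring (free_gca g)" by (rule free_gca_ring)
  interpret ring "free_gca g" by (rule ring)
  have sub: "p \<in> C \<Longrightarrow> p \<in> carrier (free_gca g)" for p using C by (rule gca_stableD)
  show "subgroup C (add_monoid (free_gca g))"
  proof (rule add.subgroupI)
    fix a assume a: "a \<in> C"
    have "(\<lambda>U. -1 * a U) \<in> C" using C a by (rule gca_stableD)
    then show "\<ominus>\<^bsub>free_gca g\<^esub> a \<in> C" using a sub by (simp add: free_gca_a_inv)
  qed (use C sub gca_stableD(2)[OF C] in \<open>auto simp: gca_stable_def free_gca_add\<close>)
  fix a x assume a: "a \<in> C" and x: "x \<in> carrier (free_gca g)"
  have "monomial S \<otimes>\<^bsub>free_gca g\<^esub> p \<in> C \<and> p \<otimes>\<^bsub>free_gca g\<^esub> monomial S \<in> C"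
    if "S \<subseteq> {1..2*g}" "p \<in> C" for S p
  proof -
    have "finite S" using that finite_subset by blast
    then show ?thesis using that
    proof (induction S arbitrary: p rule: finite_linorder_min_induct)
      case empty
      then show ?case using sub by (simp add: free_gca_one_mult)
    next
      case (insert b A)
      have b: "b \<in> {1..2*g}" and A: "A \<subseteq> {1..2*g}" using insert by auto
      have eq: "monomial (insert b A) = monomial {b} \<otimes>\<^bsub>free_gca g\<^esub> monomial A"
        using insert by (intro monomial_insert_min) auto
      have "p \<otimes>\<^bsub>free_gca g\<^esub> monomial {b} \<in> C"
        using gca_stableD[OF C] insert.prems(2) b by (simp add: mult_monomial_singleton)
      then have "p \<otimes>\<^bsub>free_gca g\<^esub> monomial (insert b A) \<in> C"
        using insert.IH A unfolding eq by (simp flip: free_gca_assoc)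
      moreover have "monomial A \<otimes>\<^bsub>free_gca g\<^esub> p \<in> C" using insert A by blast
      then have "monomial (insert b A) \<otimes>\<^bsub>free_gca g\<^esub> p \<in> C"
        using gca_stableD[OF C] b unfolding eq free_gca_assoc by (simp add: monomial_singleton_mult)
      ultimately show ?case by blast
    qed
  qed
  then show "x \<otimes>\<^bsub>free_gca g\<^esub> a \<in> C" "a \<otimes>\<^bsub>free_gca g\<^esub> x \<in> C"
    using a x by (auto simp: mult_expand_left[of x] mult_expand_right[of x] intro!: gca_stable_sum[OF C])
qed

text \<open>Lets an abstract ideal be handled with the coordinate operators, which are
  multiplications by elements of the ring.\<close>

lemma ideal_free_gca_closed:
  assumes "ideal J (free_gca g)" "p \<in> J"
  shows "(\<lambda>U. r * p U) \<in> J" "i \<in> {1..2*g} \<Longrightarrow> wedge i p \<in> J"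
    "q \<in> J \<Longrightarrow> (\<lambda>U. p U + q U) \<in> J"
proof -
  interpret ideal J "free_gca g" by fact
  have p: "p \<in> carrier (free_gca g)" using assms(2) by (rule a_Hcarr)
  show "q \<in> J \<Longrightarrow> (\<lambda>U. p U + q U) \<in> J" using additive_subgroup.a_closed[OF is_additive_subgroup assms(2)] by (simp add: free_gca_add)
  show "i \<in> {1..2*g} \<Longrightarrow> wedge i p \<in> J"
    using I_l_closed[OF assms(2) monomial_carrier[of "{i}"]] by (simp add: monomial_singleton_mult[OF p])
  show "(\<lambda>U. r * p U) \<in> J"
    using I_l_closed[OF assms(2) scalar_carrier[of r]] by (simp only: scalar_mult(1)[OF p])
qed

subsection \<open>The kernel of the Macdonald map\<close>

text \<open>The product of \<open>tensor_power\<close> with \<open>n\<close> replaced by the length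
  of the word at which it is evaluated, so that recursion on the word becomes possible.\<close>

definition tmul :: "nat \<Rightarrow> (cls list \<Rightarrow> rat) \<Rightarrow> (cls list \<Rightarrow> rat) \<Rightarrow> cls list \<Rightarrow> rat" where
  "tmul g u v w = (\<Sum>a\<in>tensor_basis g (length w). \<Sum>b\<in>tensor_basis g (length w).
     u a * v b * mult_sign a b *
     pure_tensor (map2 (\<lambda>c d. single c \<otimes>\<^bsub>surface_cohomology g\<^esub> single d) a b) w)"

definition word_deg :: "cls list \<Rightarrow> nat" where
  "word_deg w = sum_list (map cls_deg w)"

text \<open>The Koszul sign picked up when a class of degree \<open>k\<close> moves past the tensor
  \<open>u\<close>.\<close>

definition twist :: "nat \<Rightarrow> (cls list \<Rightarrow> rat) \<Rightarrow> cls list \<Rightarrow> rat" where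
  "twist k u = (\<lambda>w. (-1) ^ (k * word_deg w) * u w)"

section \<open>The tensor product by recursion on words\<close>

lemma finite_surface_basis [simp]: "finite (surface_basis g)"
  by (simp add: surface_basis_def)

lemma One_in_basis [simp]: "One \<in> surface_basis g" and Beta_in_basis [simp]: "Beta \<in> surface_basis g"
  and Alpha_in_basis [simp]: "Alpha i \<in> surface_basis g \<longleftrightarrow> i \<in> {1..2*g}"
  by (auto simp: surface_basis_def)

lemma tensor_basis_Suc:
  "tensor_basis g (Suc n) = (\<lambda>(c, w). c # w) ` (surface_basis g \<times> tensor_basis g n)"
  by (auto simp: tensor_basis_def length_Suc_conv image_iff)

lemma finite_tensor_basis [simp]: "finite (tensor_basis g n)"
  using finite_lists_length_eq[OF finite_surface_basis[of g], of n]
  by (simp add: tensor_basis_def conj_commute)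

lemma sum_tensor_basis_Suc:
  "(\<Sum>a\<in>tensor_basis g (Suc n). f a) = (\<Sum>c\<in>surface_basis g. \<Sum>w\<in>tensor_basis g n. f (c # w))"
proof -
  have "(\<Sum>a\<in>tensor_basis g (Suc n). f a) = (\<Sum>(c, w)\<in>surface_basis g \<times> tensor_basis g n. f (c # w))"
    unfolding tensor_basis_Suc by (subst sum.reindex) (auto simp: inj_on_def case_prod_beta)
  then show ?thesis by (simp add: sum.cartesian_product)
qed

lemma pure_tensor_Cons: "pure_tensor (u # us) (c # w) = u c * pure_tensor us w"
  by (simp add: pure_tensor_def prod.lessThan_Suc_shift del: prod.lessThan_Suc)

lemma word_deg_nth: "word_deg x = (\<Sum>i<length x. cls_deg (x ! i))"
  by (simp add: word_deg_def sum_list_sum_nth atLeast0LessThan)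

lemma mult_sign_Cons:
  "mult_sign (a # x) (b # y) = (-1) ^ (cls_deg b * word_deg x) * mult_sign x y"
proof -
  have "(\<Sum>i<length (a # x). \<Sum>j<i. cls_deg ((a # x) ! i) * cls_deg ((b # y) ! j))
    = cls_deg b * word_deg x + (\<Sum>i<length x. \<Sum>j<i. cls_deg (x ! i) * cls_deg (y ! j))"
    by (simp add: sum.lessThan_Suc_shift word_deg_nth sum.distrib sum_distrib_left mult.commute
        del: sum.lessThan_Suc)
  then show ?thesis by (simp only: mult_sign_def power_add)
qed

lemma single_mult:
  assumes "a \<in> surface_basis g" "b \<in> surface_basis g"
  shows "(single a \<otimes>\<^bsub>surface_cohomology g\<^esub> single b) c = cup_basis g a b c"
proof -
  have "(single a \<otimes>\<^bsub>surface_cohomology g\<^esub> single b) c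
    = (\<Sum>a'\<in>surface_basis g. \<Sum>b'\<in>surface_basis g.
        if b' = b then (if a' = a then cup_basis g a b c else 0) else 0)"
    unfolding surface_cohomology_def by (auto simp only: single_def ring.simps monoid.simps intro!: sum.cong) simp_all
  then show ?thesis using assms by simp
qed

text \<open>The first positions multiply by \<open>cup_basis\<close>. The first letter
  \<open>b\<close> of the right factor has to pass the tail of the left one, which gives the
  \<open>twist\<close>.\<close>

lemma tmul_Cons:
  "tmul g u v (c # w) = (\<Sum>a\<in>surface_basis g. \<Sum>b\<in>surface_basis g.
     cup_basis g a b c * tmul g (twist (cls_deg b) (\<lambda>x. u (a # x))) (\<lambda>y. v (b # y)) w)"
proof -
  let ?m = "\<lambda>c d. single c \<otimes>\<^bsub>surface_cohomology g\<^esub> single d"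
  let ?B = "surface_basis g" and ?T = "tensor_basis g (length w)"
  have "tmul g u v (c # w) = (\<Sum>a\<in>?B. \<Sum>x\<in>?T. \<Sum>b\<in>?B. \<Sum>y\<in>?T.
     cup_basis g a b c * (twist (cls_deg b) (\<lambda>x. u (a # x)) x * v (b # y) * mult_sign x y
       * pure_tensor (map2 ?m x y) w))"
    unfolding tmul_def list.size sum_tensor_basis_Suc add_0_right add_Suc_right
    by (intro sum.cong refl)
      (simp add: mult_sign_Cons pure_tensor_Cons twist_def single_mult mult_ac)
  also have "\<dots> = (\<Sum>a\<in>?B. \<Sum>b\<in>?B. \<Sum>x\<in>?T. \<Sum>y\<in>?T.
     cup_basis g a b c * (twist (cls_deg b) (\<lambda>x. u (a # x)) x * v (b # y) * mult_sign x y
       * pure_tensor (map2 ?m x y) w))"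
    by (intro sum.cong refl sum.swap)
  finally show ?thesis unfolding tmul_def sum_distrib_left .
qed

lemma tmul_Nil [simp]: "tmul g u v [] = u [] * v []"
proof -
  have "tensor_basis g 0 = {[]}" by (auto simp: tensor_basis_def)
  then show ?thesis by (simp add: tmul_def mult_sign_def pure_tensor_def)
qed

lemma tmul_scale_left: "tmul g (\<lambda>x. r * u x) v w = r * tmul g u v w"
  and tmul_scale_right: "tmul g u (\<lambda>x. r * v x) w = r * tmul g u v w"
  by (simp_all add: tmul_def sum_distrib_left mult_ac)

lemma tmul_zero_left [simp]: "tmul g (\<lambda>x. 0) v w = 0"
  and tmul_zero_right [simp]: "tmul g u (\<lambda>x. 0) w = 0"
  by (simp_all add: tmul_def)

lemma tmul_add_left: "tmul g (\<lambda>x. u x + u' x) v w = tmul g u v w + tmul g u' v w"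
  and tmul_add_right: "tmul g u (\<lambda>x. v x + v' x) w = tmul g u v w + tmul g u v' w"
  by (simp_all add: tmul_def sum.distrib algebra_simps)

lemma tmul_sum_left: "tmul g (\<lambda>x. \<Sum>s\<in>A. f s x) v w = (\<Sum>s\<in>A. tmul g (f s) v w)"
  by (induction A rule: infinite_finite_induct) (simp_all add: tmul_add_left)

lemma tmul_sum_right: "tmul g u (\<lambda>x. \<Sum>s\<in>A. f s x) w = (\<Sum>s\<in>A. tmul g u (f s) w)"
  by (induction A rule: infinite_finite_induct) (simp_all add: tmul_add_right)

lemma tmul_cong:
  assumes "\<And>x. x \<in> tensor_basis g (length w) \<Longrightarrow> u x = u' x"
    and "\<And>x. x \<in> tensor_basis g (length w) \<Longrightarrow> v x = v' x"
  shows "tmul g u v w = tmul g u' v' w"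
  unfolding tmul_def using assms by (intro sum.cong) auto

lemma cup_basis_support:
  assumes "a \<in> surface_basis g" "b \<in> surface_basis g" "c \<notin> surface_basis g"
  shows "cup_basis g a b c = 0"
proof -
  have "c \<noteq> a" "c \<noteq> b" "c \<noteq> Beta" using assms by auto
  then show ?thesis by (cases a; cases b) (auto simp: single_def)
qed

lemma tmul_support: "\<not> set w \<subseteq> surface_basis g \<Longrightarrow> tmul g u v w = 0"
proof (induction w arbitrary: u v)
  case (Cons c w)
  then show ?case unfolding tmul_Cons
    by (cases "c \<in> surface_basis g") (auto simp: cup_basis_support intro!: sum.neutral)
qed simp

lemma tensor_power_mult:
  "(u \<otimes>\<^bsub>tensor_power g n\<^esub> v) w = (if w \<in> tensor_basis g n then tmul g u v w else 0)"
proof (cases "length w = n")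
  case True
  then have "(u \<otimes>\<^bsub>tensor_power g n\<^esub> v) w = tmul g u v w"
    by (simp add: tensor_power_def tmul_def)
  then show ?thesis using True tmul_support[of w g u v] by (auto simp: tensor_basis_def)
next
  case False
  then have "(u \<otimes>\<^bsub>tensor_power g n\<^esub> v) w = 0"
    by (auto simp: tensor_power_def pure_tensor_def tensor_basis_def intro!: sum.neutral)
  then show ?thesis using False by (simp add: tensor_basis_def)
qed

text \<open>The coefficient of a word in the image of \<open>e\<^sub>S y\<^sup>q\<close>; the factor \<open>q!\<close> builds up in the last equation.\<close>

fun word_coeff :: "nat set \<Rightarrow> nat \<Rightarrow> cls list \<Rightarrow> rat" where
  "word_coeff S q [] = (if S = {} \<and> q = 0 then 1 else 0)"
| "word_coeff S q (One # w) = word_coeff S q w"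
| "word_coeff S q (Alpha j # w) = (if j \<in> S then sg j S * word_coeff (S - {j}) q w else 0)"
| "word_coeff S q (Beta # w) = of_nat q * word_coeff S (q - 1) w"

text \<open>A word determines the pair \<open>S\<close>, \<open>q\<close>, so different pairs have
  disjoint supports. The length bound later yields the kernel, the degree the sign in
  \<open>twist_word_coeff\<close>.\<close>

lemma word_coeff_nonzero:
  "word_coeff S q w \<noteq> 0 \<Longrightarrow> S = {j. Alpha j \<in> set w} \<and> q = count_list w Beta
     \<and> card S + q \<le> length w \<and> word_deg w = card S + 2 * q"
proof (induction S q w rule: word_coeff.induct)
  case (3 S q j w)
  have j: "j \<in> S" using 3(2) by (simp split: if_splits)
  then have "word_coeff (S - {j}) q w \<noteq> 0" using 3(2) by auto
  note IH = 3(1)[OF j this]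
  then have S: "S - {j} = {i. Alpha i \<in> set w}" by blast
  \<comment> \<open>Finiteness of \<open>S - {j}\<close>, on which the count by
    \<open>card.remove\<close> rests, comes from the finitely many letters of
    \<open>w\<close>.\<close>
  have "{i. Alpha i \<in> set w} = Alpha -` set w" by auto
  then have "finite (S - {j})" unfolding S by (simp add: finite_vimageI inj_def)
  then have card: "card S = Suc (card (S - {j}))"
    using j by (intro card.remove) (simp_all only: finite_Diff_insert finite_Diff finite.emptyI Diff_empty)
  have "S = insert j (S - {j})" using j by blast
  also have "\<dots> = {i. Alpha i \<in> set (Alpha j # w)}" unfolding S by auto
  finally have "S = {i. Alpha i \<in> set (Alpha j # w)}" .
  moreover have "q = count_list (Alpha j # w) Beta" using IH by simp
  moreover have "card (S - {j}) + q \<le> length w" using IH by (elim conjE)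
  then have "card S + q \<le> length (Alpha j # w)" unfolding card by simp
  moreover have "word_deg (Alpha j # w) = card S + 2 * q"
    using IH unfolding card by (simp add: word_deg_def)
  ultimately show ?case by blast
next
  case (4 S q w)
  then have "q > 0" "word_coeff S (q - 1) w \<noteq> 0" by (auto intro!: Nat.gr0I)
  then show ?case using 4 by (auto simp: word_deg_def)
qed (auto simp: word_deg_def split: if_splits)

text \<open>All words in the support have degree \<open>card S + 2 * q\<close>, so the twist is one
  common sign.\<close>

lemma twist_word_coeff: "twist k (word_coeff S q) = (\<lambda>w. (-1) ^ (k * card S) * word_coeff S q w)"
proof
  fix w
  show "twist k (word_coeff S q) w = (-1) ^ (k * card S) * word_coeff S q w"
  proof (cases "word_coeff S q w = 0")
    case False
    then have "word_deg w = card S + 2 * q" using word_coeff_nonzero by blast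
    then show ?thesis by (simp add: twist_def power_add distrib_left mult.left_commute[of k 2])
  qed (simp add: twist_def)
qed

lemma sum_surface_basis:
  "(\<Sum>c\<in>surface_basis g. f c) = f One + f Beta + (\<Sum>i\<in>{1..2*g}. f (Alpha i))"
proof -
  have "(\<Sum>c\<in>surface_basis g. f c) = (\<Sum>c\<in>{One, Beta}. f c) + (\<Sum>c\<in>Alpha ` {1..2*g}. f c)"
    unfolding surface_basis_def by (rule sum.union_disjoint) auto
  then show ?thesis by (simp add: sum.reindex inj_on_def)
qed

lemma cup_basis_One_right [simp]: "cup_basis g a One = single a"
  by (cases a) auto

lemma cup_basis_Alpha_Alpha:
  assumes "i \<in> {1..2*g}" "j \<in> {1..2*g}"
  shows "cup_basis g (Alpha i) (Alpha j) c = (if j = partner g i then orient g i * single Beta c else 0)"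
  using assms by (auto simp: partner_def orient_def)

declare cup_basis.simps(4-) [simp del]

lemma cup_basis_Beta [simp]:
  "cup_basis g (Alpha i) Beta c = 0" "cup_basis g Beta (Alpha i) c = 0" "cup_basis g Beta Beta c = 0"
  by (simp_all add: cup_basis.simps)

lemma sum_single: "c \<in> surface_basis g \<Longrightarrow> (\<Sum>b\<in>surface_basis g. single b c * f b) = f c"
proof -
  assume c: "c \<in> surface_basis g"
  have "(\<Sum>b\<in>surface_basis g. single b c * f b) = (\<Sum>b\<in>surface_basis g. if b = c then f c else 0)"
    by (intro sum.cong) (auto simp: single_def)
  then show ?thesis using c by simp
qed

lemma twist_0 [simp]: "twist 0 u = u" and twist_2 [simp]: "twist 2 u = u"
  by (simp_all add: twist_def)

text \<open>\<open>word_coeff {} 0\<close> is the unit tensor: it vanishes on words beginning with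
  \<open>Alpha\<close> or \<open>Beta\<close>, so the recursion keeps only the head
  \<open>One\<close>.\<close>

lemma tmul_one_left: "set w \<subseteq> surface_basis g \<Longrightarrow> tmul g (word_coeff {} 0) v w = v w"
proof (induction w arbitrary: v)
  case (Cons c w)
  let ?F = "\<lambda>a. \<Sum>b\<in>surface_basis g. cup_basis g a b c
      * tmul g (twist (cls_deg b) (\<lambda>x. word_coeff {} 0 (a # x))) (\<lambda>y. v (b # y)) w"
  have "tmul g (word_coeff {} 0) v (c # w) = ?F One + ?F Beta + (\<Sum>j\<in>{1..2*g}. ?F (Alpha j))"
    unfolding tmul_Cons by (rule sum_surface_basis)
  also have "\<dots> = (\<Sum>b\<in>surface_basis g. single b c * tmul g (word_coeff {} 0) (\<lambda>y. v (b # y)) w)"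
    by (simp add: twist_word_coeff twist_def[of _ "\<lambda>_. 0"])
  finally have "tmul g (word_coeff {} 0) v (c # w)
     = (\<Sum>b\<in>surface_basis g. single b c * tmul g (word_coeff {} 0) (\<lambda>y. v (b # y)) w)" .
  then show ?case using Cons by (simp add: sum_single)
qed simp

text \<open>The left factor is the odd class of \<alpha>_i. Either \<alpha>_i sits in the tail, and
  the first letter passes it with a sign, or it sits in front, where it meets \<open>One\<close> or
  its partner.\<close>

lemma tmul_letter_Cons:
  assumes i: "i \<in> {1..2*g}" and c: "c \<in> surface_basis g" and w: "set w \<subseteq> surface_basis g"
  shows "tmul g (word_coeff {i} 0) v (c # w)
    = (-1) ^ cls_deg c * tmul g (word_coeff {i} 0) (\<lambda>y. v (c # y)) w
      + (case c of One \<Rightarrow> 0 | Alpha j \<Rightarrow> if j = i then v (One # w) else 0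
         | Beta \<Rightarrow> orient g i * v (Alpha (partner g i) # w))"
proof -
  let ?B = "surface_basis g"
  let ?F = "\<lambda>a b. cup_basis g a b c
      * tmul g (twist (cls_deg b) (\<lambda>x. word_coeff {i} 0 (a # x))) (\<lambda>y. v (b # y)) w"
  have "tmul g (word_coeff {i} 0) v (c # w)
     = (\<Sum>b\<in>?B. ?F One b) + (\<Sum>b\<in>?B. ?F Beta b) + (\<Sum>j\<in>{1..2*g}. \<Sum>b\<in>?B. ?F (Alpha j) b)"
    unfolding tmul_Cons by (rule sum_surface_basis)
  also have "(\<Sum>b\<in>?B. ?F Beta b) = 0"
    by (simp add: twist_def)
  also have "(\<Sum>b\<in>?B. ?F One b) = (\<Sum>b\<in>?B. single b c
      * ((-1) ^ cls_deg b * tmul g (word_coeff {i} 0) (\<lambda>y. v (b # y)) w))"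
    by (simp add: twist_word_coeff tmul_scale_left)
  also have "\<dots> = (-1) ^ cls_deg c * tmul g (word_coeff {i} 0) (\<lambda>y. v (c # y)) w"
    using c by (rule sum_single)
  also have "(\<Sum>j\<in>{1..2*g}. \<Sum>b\<in>?B. ?F (Alpha j) b)
      = (\<Sum>j\<in>{1..2*g}. if j = i then \<Sum>b\<in>?B. cup_basis g (Alpha i) b c * v (b # w) else 0)"
    using w by (intro sum.cong refl)
      (auto simp: twist_word_coeff twist_def[of _ "\<lambda>_. 0"] tmul_one_left)
  also have "\<dots> = (\<Sum>b\<in>?B. cup_basis g (Alpha i) b c * v (b # w))"
    using i by simp
  also have "\<dots> = single (Alpha i) c * v (One # w)
      + (\<Sum>j\<in>{1..2*g}. if j = partner g i then orient g i * single Beta c * v (Alpha (partner g i) # w) else 0)"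
    unfolding sum_surface_basis using i
    by (intro arg_cong2[where f = "(+)"] sum.cong) (auto simp: cup_basis_Alpha_Alpha)
  also have "\<dots> = single (Alpha i) c * v (One # w) + orient g i * single Beta c * v (Alpha (partner g i) # w)"
    using partner_in[OF i] by simp
  finally show ?thesis by (cases c) (auto simp: single_def)
qed

text \<open>The rule for x_i e_S on words: \<alpha>_i replaces a \<open>One\<close>, or meets its
  partner and makes a \<beta>. In the second case each of the q + 1 letters \<open>Beta\<close> may
  be the new one, which turns q! into (q + 1)!. For \<open>i\<close> in \<open>S\<close> the two
  ways to obtain \<alpha>_i twice cancel.\<close>

lemma tmul_letter_word_coeff:
  assumes i: "i \<in> {1..2*g}" and w: "set w \<subseteq> surface_basis g"
  shows "tmul g (word_coeff {i} 0) (word_coeff S q) w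
    = (if i \<in> S then 0 else sg i S * word_coeff (insert i S) q w)
      + (if partner g i \<in> S
         then orient g i * sg (partner g i) S * word_coeff (S - {partner g i}) (Suc q) w else 0)"
  using w
proof (induction w arbitrary: S q)
  case Nil
  then show ?case by simp
next
  case (Cons c w)
  note step = tmul_letter_Cons[OF i, of c w]
  note neq = partner_neq[OF i]
  show ?case
  proof (cases c)
    case One
    then show ?thesis using Cons step by simp
  next
    case (Alpha j)
    then have "tmul g (word_coeff {i} 0) (word_coeff S q) (c # w)
      = - (if j \<in> S then sg j S * tmul g (word_coeff {i} 0) (word_coeff (S - {j}) q) w else 0)
        + (if j = i then word_coeff S q w else 0)"
      using Cons.prems step by (simp add: tmul_scale_right)
    then show ?thesis using Cons Alpha neq
      by (auto simp: sg_insert sg_remove insert_Diff_if insert_absorb Diff_insert2[symmetric]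
          insert_commute algebra_simps)
  next
    case Beta
    then have "tmul g (word_coeff {i} 0) (word_coeff S q) (c # w)
      = of_nat q * tmul g (word_coeff {i} 0) (word_coeff S (q - 1)) w
        + orient g i * word_coeff S q (Alpha (partner g i) # w)"
      using Cons.prems step by (simp add: tmul_scale_right)
    \<comment> \<open>At \<open>q = 0\<close> the factor \<open>of_nat q\<close> kills the term with
      the truncated \<open>q - 1\<close>.\<close>
    then show ?thesis using Cons Beta
      by (cases q) (auto simp: algebra_simps)
  qed
qed

text \<open>The right factor is a power of \<eta>. A \<beta> survives only against
  \<open>One\<close>, so the head of the product is either a head of \<open>u\<close> or a
  \<open>Beta\<close> placed over \<open>One\<close>.\<close>

lemma tmul_Beta_power_Cons:
  assumes c: "c \<in> surface_basis g"
  shows "tmul g u (word_coeff {} q) (c # w) = tmul g (\<lambda>x. u (c # x)) (word_coeff {} q) w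
    + (if c = Beta then of_nat q * tmul g (\<lambda>x. u (One # x)) (word_coeff {} (q - 1)) w else 0)"
proof -
  let ?B = "surface_basis g"
  let ?F = "\<lambda>a b. cup_basis g a b c
      * tmul g (twist (cls_deg b) (\<lambda>x. u (a # x))) (\<lambda>y. word_coeff {} q (b # y)) w"
  have "tmul g u (word_coeff {} q) (c # w) = (\<Sum>b\<in>?B. \<Sum>a\<in>?B. ?F a b)"
    unfolding tmul_Cons by (rule sum.swap)
  also have "\<dots> = (\<Sum>a\<in>?B. ?F a One) + (\<Sum>a\<in>?B. ?F a Beta) + (\<Sum>j\<in>{1..2*g}. \<Sum>a\<in>?B. ?F a (Alpha j))"
    by (rule sum_surface_basis)
  also have "(\<Sum>j\<in>{1..2*g}. \<Sum>a\<in>?B. ?F a (Alpha j)) = 0" by simp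
  also have "(\<Sum>a\<in>?B. ?F a One) = tmul g (\<lambda>x. u (c # x)) (word_coeff {} q) w"
    using c by (simp add: sum_single)
  also have "(\<Sum>a\<in>?B. ?F a Beta) = single Beta c * (of_nat q * tmul g (\<lambda>x. u (One # x)) (word_coeff {} (q - 1)) w)"
    unfolding sum_surface_basis by (simp add: tmul_scale_right)
  finally show ?thesis by (simp add: single_def)
qed

text \<open>For the head \<open>Beta\<close> the recursion is a Leibniz rule whose factors
  \<open>r\<close> and \<open>q\<close> add up to \<open>r + q\<close>.\<close>

lemma tmul_word_coeff_Beta_power:
  "set w \<subseteq> surface_basis g \<Longrightarrow> tmul g (word_coeff S r) (word_coeff {} q) w = word_coeff S (r + q) w"
proof (induction w arbitrary: S r q)
  case (Cons c w)
  then show ?case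
    by (cases c; cases r; cases q) (auto simp: tmul_Beta_power_Cons tmul_scale_left tmul_add_left algebra_simps)
qed simp

section \<open>The generating classes as coefficient functions on words\<close>

lemma pure_tensor_one:
  "length w = n \<Longrightarrow> pure_tensor (replicate n \<one>\<^bsub>surface_cohomology g\<^esub>) w = word_coeff {} 0 w"
proof (induction w arbitrary: n)
  case (Cons c w)
  then show ?case
    by (cases c; cases n) (auto simp: pure_tensor_Cons surface_cohomology_def single_def)
qed (simp add: pure_tensor_def)

lemma chi_Suc:
  "chi g (Suc n) \<gamma> (c # w) = \<gamma> c * pure_tensor (replicate n \<one>\<^bsub>surface_cohomology g\<^esub>) w
    + single One c * chi g n \<gamma> w"
  by (simp add: chi_def sum.lessThan_Suc_shift pure_tensor_Cons sum_distrib_left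
      surface_cohomology_def del: sum.lessThan_Suc)

lemma chi_word_coeff:
  assumes "length w = n"
  shows "chi g n (single (Alpha i)) w = word_coeff {i} 0 w"
    and "chi g n (single Beta) w = word_coeff {} 1 w"
  using assms
proof (induction w arbitrary: n)
  case Nil
  { case 1 then show ?case using Nil by (simp add: chi_def) }
  { case 2 then show ?case using Nil by (simp add: chi_def) }
next
  case (Cons c w)
  { case 1 then show ?case using Cons
      by (cases c; cases n) (auto simp: chi_Suc pure_tensor_one single_def) }
  { case 2 then show ?case using Cons
      by (cases c; cases n) (auto simp: chi_Suc pure_tensor_one single_def) }
qed

text \<open>The image in the tensor power of the element with coordinates \<open>p\<close> in the
  basis (e_S). On words of length \<open>n\<close> the bound \<open>q \<le> n\<close> cuts off only
  zero terms, by \<open>word_coeff_eq_0\<close>.\<close>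

definition realize :: "nat \<Rightarrow> nat \<Rightarrow> (nat set \<Rightarrow> rat poly) \<Rightarrow> cls list \<Rightarrow> rat" where
  "realize g n p w = (\<Sum>S\<in>Pow {1..2*g}. \<Sum>q\<le>n. coeff (p S) q * word_coeff S q w)"

lemma realize_add: "realize g n (\<lambda>U. p U + r U) w = realize g n p w + realize g n r w"
  by (simp add: realize_def algebra_simps sum.distrib)

lemma realize_smult: "realize g n (\<lambda>U. smult a (p U)) w = a * realize g n p w"
  by (simp add: realize_def sum_distrib_left mult_ac)

lemma realize_zero: "realize g n (\<lambda>U. 0) w = 0"
  by (simp add: realize_def)

lemma realize_sum: "realize g n (\<lambda>U. \<Sum>s\<in>A. f s U) w = (\<Sum>s\<in>A. realize g n (f s) w)"
  by (induction A rule: infinite_finite_induct) (simp_all add: realize_add realize_zero)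

text \<open>Multiplication by y^q shifts coefficients; terms pushed beyond \<open>n\<close> vanish
  by the assumption on \<open>h\<close>.\<close>

lemma sum_shift_truncated:
  fixes f h :: "nat \<Rightarrow> rat"
  assumes "\<And>k. k > n \<Longrightarrow> h k = 0"
  shows "(\<Sum>r\<le>n. f r * h (r + q)) = (\<Sum>k\<le>n. (if k < q then 0 else f (k - q)) * h k)"
proof -
  have "(\<Sum>r\<le>n. f r * h (r + q)) = (\<Sum>r | r + q \<le> n. f r * h (r + q))"
    using assms by (intro sum.mono_neutral_right) auto
  also have "\<dots> = (\<Sum>k\<in>{q..n}. f (k - q) * h k)"
    by (intro sum.reindex_bij_witness[of _ "\<lambda>k. k - q" "\<lambda>r. r + q"]) auto
  also have "\<dots> = (\<Sum>k\<le>n. (if k < q then 0 else f (k - q)) * h k)"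
    by (intro sum.mono_neutral_cong_left) auto
  finally show ?thesis .
qed

lemma word_coeff_eq_0: "q > length w \<Longrightarrow> word_coeff S q w = 0"
  using word_coeff_nonzero[of S q w] by (cases "word_coeff S q w = 0") auto

lemma realize_monom_mult:
  assumes "length w = n"
  shows "realize g n (\<lambda>U. monom 1 k * p U) w
    = (\<Sum>S\<in>Pow {1..2*g}. \<Sum>q\<le>n. coeff (p S) q * word_coeff S (q + k) w)"
  unfolding realize_def using assms
  by (subst sum_shift_truncated) (auto simp: word_coeff_eq_0 coeff_monom_mult intro!: sum.cong)

lemma tmul_realize_Beta_power:
  assumes "w \<in> tensor_basis g n"
  shows "tmul g (realize g n p) (word_coeff {} k) w = realize g n (\<lambda>U. monom 1 k * p U) w"
proof -
  have "tmul g (realize g n p) (word_coeff {} k) w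
     = (\<Sum>S\<in>Pow {1..2*g}. \<Sum>q\<le>n. coeff (p S) q * tmul g (word_coeff S q) (word_coeff {} k) w)"
    unfolding realize_def[abs_def] by (simp only: tmul_sum_left tmul_scale_left)
  then show ?thesis using assms
    by (simp add: realize_monom_mult tensor_basis_def tmul_word_coeff_Beta_power)
qed

lemma coeff_sg_mult: "coeff (sg i S * p) q = sg i S * coeff p q"
  by (cases "even (card {t \<in> S. t < i})") (simp_all add: sg_def)

text \<open>The linear extension of \<open>tmul_letter_word_coeff\<close>. Its first term reindexes
  to \<open>wedge\<close>; its second, which raises the exponent, to the contraction times
  y.\<close>

lemma tmul_letter_realize:
  assumes w: "w \<in> tensor_basis g n" and i: "i \<in> {1..2*g}"
  shows "tmul g (word_coeff {i} 0) (realize g n p) w = realize g n (clifford g [:0, 1:] i p) w"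
proof -
  let ?P = "Pow {1..2*g}" and ?j = "partner g i"
  have len: "length w = n" and set: "set w \<subseteq> surface_basis g" using w by (auto simp: tensor_basis_def)
  have "tmul g (word_coeff {i} 0) (realize g n p) w
     = (\<Sum>S\<in>?P. \<Sum>q\<le>n. coeff (p S) q * tmul g (word_coeff {i} 0) (word_coeff S q) w)"
    unfolding realize_def[abs_def] by (simp only: tmul_sum_right tmul_scale_right)
  also have "\<dots> = (\<Sum>S\<in>?P. if i \<in> S then 0 else \<Sum>q\<le>n. coeff (p S) q * (sg i S * word_coeff (insert i S) q w))
     + (\<Sum>S\<in>?P. if ?j \<in> S then \<Sum>q\<le>n. coeff (p S) q *
          (orient g i * sg ?j S * word_coeff (S - {?j}) (Suc q) w) else 0)"
    unfolding tmul_letter_word_coeff[OF i set] distrib_left sum.distrib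
    by (intro arg_cong2[where f = "(+)"] sum.cong) auto
  also have "(\<Sum>S\<in>?P. if i \<in> S then 0 else \<Sum>q\<le>n. coeff (p S) q * (sg i S * word_coeff (insert i S) q w))
     = (\<Sum>S\<in>?P. if i \<in> S then \<Sum>q\<le>n. coeff (p (S - {i})) q * (sg i S * word_coeff S q w) else 0)"
    using i by (subst sum_Pow_remove) (auto simp: sg_remove insert_absorb intro!: sum.cong)
  also have "\<dots> = realize g n (wedge i p) w"
    unfolding realize_def by (intro sum.cong) (auto simp: wedge_def coeff_sg_mult mult_ac)
  also have "(\<Sum>S\<in>?P. if ?j \<in> S then \<Sum>q\<le>n. coeff (p S) q *
          (orient g i * sg ?j S * word_coeff (S - {?j}) (Suc q) w) else 0)
     = (\<Sum>S\<in>?P. if ?j \<in> S then 0 else \<Sum>q\<le>n. coeff (p (insert ?j S)) q *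
          (orient g i * sg ?j S * word_coeff S (Suc q) w))"
    using partner_in[OF i] by (subst sum_Pow_insert) (auto simp: sg_insert intro!: sum.cong)
  also have "\<dots> = orient g i * realize g n (\<lambda>U. monom 1 1 * contract ?j p U) w"
    unfolding realize_monom_mult[OF len] sum_distrib_left
    by (intro sum.cong) (auto simp: contract_def coeff_sg_mult mult_ac)
  also have "\<dots> = realize g n (\<lambda>U. smult (orient g i) (monom 1 1 * contract ?j p U)) w"
    by (simp only: realize_smult)
  also have "(\<lambda>U. smult (orient g i) (monom 1 1 * contract ?j p U))
      = (\<lambda>U. [:0, 1:] * orient g i * contract ?j p U)"
    by (auto simp: orient_def monom_altdef)
  finally show ?thesis unfolding clifford_def realize_add .
qed

lemma realize_monomial_empty: "realize g n (monomial {}) w = word_coeff {} 0 w"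
proof -
  have "realize g n (monomial {}) w = (\<Sum>S\<in>Pow {1..2*g}. if S = {} then word_coeff {} 0 w else 0)"
    unfolding realize_def
  proof (intro sum.cong refl)
    fix S
    have "(\<Sum>q\<le>n. coeff (1::rat poly) q * word_coeff {} q w)
      = (\<Sum>q\<le>n. if q = 0 then word_coeff {} 0 w else 0)" by (intro sum.cong) auto
    then show "(\<Sum>q\<le>n. coeff (monomial {} S) q * word_coeff S q w) = (if S = {} then word_coeff {} 0 w else 0)"
      by (simp add: monomial_def)
  qed
  then show ?thesis by simp
qed

lemma sym_cohomology_mult: "u \<otimes>\<^bsub>sym_cohomology g n\<^esub> v = u \<otimes>\<^bsub>tensor_power g n\<^esub> v"
  and sym_cohomology_one: "\<one>\<^bsub>sym_cohomology g n\<^esub> = pure_tensor (replicate n \<one>\<^bsub>surface_cohomology g\<^esub>)"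
  and sym_cohomology_zero: "\<zero>\<^bsub>sym_cohomology g n\<^esub> = (\<lambda>w. 0)"
  by (simp_all add: sym_cohomology_def tensor_power_def)

lemma odd_image_word_coeff:
  "length w = n \<Longrightarrow> odd_image g n i w = word_coeff {i} 0 w"
  by (simp add: odd_image_def xi_def xi'_def chi_word_coeff)

lemma list_prod_odd_image:
  assumes "set xs \<subseteq> {1..2*g}" "w \<in> tensor_basis g n"
  shows "list_prod (sym_cohomology g n) (map (odd_image g n) xs) w
     = realize g n (foldr (clifford g [:0, 1:]) xs (monomial {})) w"
  using assms
proof (induction xs arbitrary: w)
  case Nil
  then show ?case
    by (simp add: list_prod_def sym_cohomology_one pure_tensor_one realize_monomial_empty tensor_basis_def)
next
  case (Cons i xs)
  have len: "x \<in> tensor_basis g (length w) \<Longrightarrow> length x = n \<and> x \<in> tensor_basis g n" for x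
    using Cons.prems by (auto simp: tensor_basis_def)
  have "list_prod (sym_cohomology g n) (map (odd_image g n) (i # xs)) w
     = tmul g (odd_image g n i) (list_prod (sym_cohomology g n) (map (odd_image g n) xs)) w"
    using Cons.prems by (simp add: list_prod_def sym_cohomology_mult tensor_power_mult)
  also have "\<dots> = tmul g (word_coeff {i} 0) (realize g n (foldr (clifford g [:0, 1:]) xs (monomial {}))) w"
    using Cons len by (intro tmul_cong) (auto simp: odd_image_word_coeff)
  finally show ?case using Cons.prems by (simp add: tmul_letter_realize)
qed

lemma eta_power:
  "w \<in> tensor_basis g n \<Longrightarrow> (eta g n [^]\<^bsub>sym_cohomology g n\<^esub> (q::nat)) w = word_coeff {} q w"
proof (induction q arbitrary: w)
  case 0
  then show ?case by (simp add: nat_pow_def sym_cohomology_one pure_tensor_one tensor_basis_def)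
next
  case (Suc q)
  have len: "x \<in> tensor_basis g (length w) \<Longrightarrow> length x = n \<and> x \<in> tensor_basis g n" for x
    using Suc.prems by (auto simp: tensor_basis_def)
  have "(eta g n [^]\<^bsub>sym_cohomology g n\<^esub> Suc q) w = tmul g (eta g n [^]\<^bsub>sym_cohomology g n\<^esub> q) (eta g n) w"
    using Suc.prems by (simp add: nat_pow_def sym_cohomology_mult tensor_power_mult)
  also have "\<dots> = tmul g (word_coeff {} q) (word_coeff {} 1) w"
    using Suc len by (intro tmul_cong) (auto simp: eta_def chi_word_coeff simp del: One_nat_def)
  finally show ?case using Suc.prems by (simp add: tmul_word_coeff_Beta_power tensor_basis_def)
qed

text \<open>A product of odd variables goes to the \<open>realize\<close> of its blade with
  parameter y, and multiplication by \<eta>^q multiplies the coordinates by y^q. So the map is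
  \<open>realize\<close> after the change to the basis (e_S).\<close>

lemma macdonald_map_realize:
  "macdonald_map g n p w = (if w \<in> tensor_basis g n then realize g n (quantize g [:0, 1:] p) w else 0)"
proof (cases "w \<in> tensor_basis g n")
  case False
  then show ?thesis by (simp add: macdonald_map_def sym_cohomology_mult tensor_power_mult)
next
  case True
  then have len: "x \<in> tensor_basis g (length w) \<Longrightarrow> length x = n \<and> x \<in> tensor_basis g n" for x
    by (auto simp: tensor_basis_def)
  have summand: "(list_prod (sym_cohomology g n) (map (odd_image g n) (sorted_list_of_set S))
        \<otimes>\<^bsub>sym_cohomology g n\<^esub> (eta g n [^]\<^bsub>sym_cohomology g n\<^esub> q)) w
      = realize g n (\<lambda>U. monom 1 q * cblade g [:0, 1:] S U) w"
    if "S \<in> Pow {1..2*g}" for S q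
  proof -
    have "set (sorted_list_of_set S) \<subseteq> {1..2*g}" using that finite_subset[of S] by auto
    then have "tmul g (list_prod (sym_cohomology g n) (map (odd_image g n) (sorted_list_of_set S)))
        (eta g n [^]\<^bsub>sym_cohomology g n\<^esub> q) w
      = tmul g (realize g n (cblade g [:0, 1:] S)) (word_coeff {} q) w"
      using len by (intro tmul_cong) (auto simp: list_prod_odd_image eta_power cblade_def)
    then show ?thesis using True
      by (simp add: sym_cohomology_mult tensor_power_mult tmul_realize_Beta_power)
  qed
  have "macdonald_map g n p w = (\<Sum>S\<in>Pow {1..2*g}. \<Sum>q\<le>degree (p S). coeff (p S) q *
      realize g n (\<lambda>U. monom 1 q * cblade g [:0, 1:] S U) w)"
    unfolding macdonald_map_def using summand by (intro sum.cong) auto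
  also have "\<dots> = realize g n (\<lambda>U. \<Sum>S\<in>Pow {1..2*g}. \<Sum>q\<le>degree (p S).
      smult (coeff (p S) q) (monom 1 q * cblade g [:0, 1:] S U)) w"
    by (simp only: realize_sum realize_smult)
  also have "(\<lambda>U. \<Sum>S\<in>Pow {1..2*g}. \<Sum>q\<le>degree (p S).
      smult (coeff (p S) q) (monom 1 q * cblade g [:0, 1:] S U)) = quantize g [:0, 1:] p"
  proof
    fix U
    have "(\<Sum>q\<le>degree (p S). smult (coeff (p S) q) (monom 1 q * cblade g [:0, 1:] S U))
       = p S * cblade g [:0, 1:] S U" for S
    proof -
      \<comment> \<open>The coefficients of \<open>p S\<close> are put together again as a
        polynomial in y.\<close>
      have "(\<Sum>q\<le>degree (p S). smult (coeff (p S) q) (monom 1 q * cblade g [:0, 1:] S U))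
         = (\<Sum>q\<le>degree (p S). monom (coeff (p S) q) q) * cblade g [:0, 1:] S U"
        unfolding sum_distrib_right
        by (intro sum.cong refl) (metis mult.right_neutral mult_smult_left smult_monom)
      then show ?thesis by (simp add: poly_as_sum_of_monoms)
    qed
    then show "(\<Sum>S\<in>Pow {1..2*g}. \<Sum>q\<le>degree (p S).
      smult (coeff (p S) q) (monom 1 q * cblade g [:0, 1:] S U)) = quantize g [:0, 1:] p U"
      by (simp add: quantize_def)
  qed
  finally show ?thesis using True by simp
qed

section \<open>Independence of the word sums and the kernel\<close>

lemma word_coeff_canonical:
  assumes "finite S"
  shows "word_coeff S q (map Alpha (sorted_list_of_set S) @ replicate q Beta @ replicate k One) \<noteq> 0"
proof -
  have One: "word_coeff {} 0 (replicate k One) \<noteq> 0" by (induction k) auto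
  have Beta: "word_coeff {} q (replicate q Beta @ replicate k One) \<noteq> 0"
    using One by (induction q) auto
  have sg: "sg j T \<noteq> (0::rat)" for j T by (simp add: sg_def)
  have "distinct xs \<Longrightarrow> word_coeff (set xs) q (map Alpha xs @ replicate q Beta @ replicate k One) \<noteq> 0" for xs
    using Beta sg by (induction xs) auto
  from this[of "sorted_list_of_set S"] show ?thesis using assms by simp
qed

text \<open>The canonical word for \<open>S\<close>, \<open>q\<close> lies in the support of no
  other pair, so it reads off one coefficient. Pairs with \<open>card S + q\<close> above
  \<open>n\<close> have no words of length \<open>n\<close>.\<close>

lemma realize_eq_0_iff:
  "(\<forall>w\<in>tensor_basis g n. realize g n p w = 0) \<longleftrightarrow>
     (\<forall>S q. S \<subseteq> {1..2*g} \<and> card S + q \<le> n \<longrightarrow> coeff (p S) q = 0)"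
proof safe
  fix S q assume 0: "\<forall>w\<in>tensor_basis g n. realize g n p w = 0"
    and S: "S \<subseteq> {1..2*g}" and q: "card S + q \<le> n"
  have fin: "finite S" using S finite_subset by blast
  \<comment> \<open>Filling up with \<open>One\<close> to length \<open>n\<close> is possible
    because \<open>card S + q \<le> n\<close>.\<close>
  define w where "w = map Alpha (sorted_list_of_set S) @ replicate q Beta @ replicate (n - card S - q) One"
  have w: "w \<in> tensor_basis g n" using S fin q by (auto simp: w_def tensor_basis_def)
  have nz: "word_coeff S q w \<noteq> 0" unfolding w_def using fin by (rule word_coeff_canonical)
  have uniq: "word_coeff S' q' w \<noteq> 0 \<Longrightarrow> S' = S \<and> q' = q" for S' q'
    using word_coeff_nonzero[OF nz] word_coeff_nonzero[of S' q' w] by metis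
  have "realize g n p w = (\<Sum>S'\<in>Pow {1..2*g}. if S' = S then coeff (p S) q * word_coeff S q w else 0)"
    unfolding realize_def
  proof (intro sum.cong refl)
    fix S'
    have "(\<Sum>q'\<le>n. coeff (p S') q' * word_coeff S' q' w)
      = (\<Sum>q'\<le>n. if q' = q then (if S' = S then coeff (p S) q * word_coeff S q w else 0) else 0)"
      using uniq by (intro sum.cong) auto
    then show "(\<Sum>q'\<le>n. coeff (p S') q' * word_coeff S' q' w)
      = (if S' = S then coeff (p S) q * word_coeff S q w else 0)" using q by simp
  qed
  also have "\<dots> = coeff (p S) q * word_coeff S q w" using S by simp
  finally show "coeff (p S) q = 0" using 0 w nz by simp
next
  fix w assume 0: "\<forall>S q. S \<subseteq> {1..2*g} \<and> card S + q \<le> n \<longrightarrow> coeff (p S) q = 0"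
    and w: "w \<in> tensor_basis g n"
  have "coeff (p S) q * word_coeff S q w = 0" if "S \<subseteq> {1..2*g}" for S q
  proof (cases "card S + q \<le> n")
    case False
    then have "word_coeff S q w = 0" using word_coeff_nonzero[of S q w] w by (auto simp: tensor_basis_def)
    then show ?thesis by simp
  qed (use 0 that in auto)
  then show "realize g n p w = 0" unfolding realize_def by (intro sum.neutral ballI) auto
qed

lemma macdonald_ideal_iff:
  "p \<in> macdonald_ideal g n \<longleftrightarrow> p \<in> carrier (free_gca g) \<and>
     (\<forall>S q. S \<subseteq> {1..2*g} \<and> card S + q \<le> n \<longrightarrow> coeff (quantize g [:0, 1:] p S) q = 0)"
  unfolding macdonald_ideal_def a_kernel_defs realize_eq_0_iff[symmetric]
  by (auto simp: sym_cohomology_zero fun_eq_iff macdonald_map_realize)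

subsection \<open>Propagation along the multiplication rules\<close>

text \<open>The exceptional sets: outside of them some \<open>i\<close> in \<open>S\<close> lacks
  its partner, and then a single multiplication isolates one term.\<close>

definition partner_closed :: "nat \<Rightarrow> nat set \<Rightarrow> bool" where
  "partner_closed g S \<longleftrightarrow> (\<forall>i\<in>S. partner g i \<in> S)"

lemma partner_closed_decompose:
  assumes "S \<subseteq> {1..2*g}" "partner_closed g S"
  shows "S = (S \<inter> {1..g}) \<union> (\<lambda>k. k + g) ` (S \<inter> {1..g})"
proof
  show "S \<subseteq> (S \<inter> {1..g}) \<union> (\<lambda>k. k + g) ` (S \<inter> {1..g})"
  proof
    fix i assume i: "i \<in> S"
    then have "partner g i \<in> S" using assms by (simp add: partner_closed_def)
    then show "i \<in> (S \<inter> {1..g}) \<union> (\<lambda>k. k + g) ` (S \<inter> {1..g})"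
      using i subsetD[OF assms(1) i]
      by (cases "i \<le> g") (auto simp: partner_def image_iff intro!: bexI[of _ "i - g"])
  qed
  show "(S \<inter> {1..g}) \<union> (\<lambda>k. k + g) ` (S \<inter> {1..g}) \<subseteq> S"
    using assms(2) by (force simp: partner_closed_def partner_def)
qed

text \<open>Exceptional sets of cardinality \<open>n\<close> thus occur only for even
  \<open>n\<close>, the case in which \<open>closed_base\<close> provides one.\<close>

lemma partner_closed_even_card:
  assumes "S \<subseteq> {1..2*g}" "partner_closed g S"
  shows "even (card S)"
proof -
  let ?A = "S \<inter> {1..g}"
  have "card (?A \<union> (\<lambda>k. k + g) ` ?A) = card ?A + card ((\<lambda>k. k + g) ` ?A)"
    by (rule card_Un_disjoint) auto
  then have "card S = card ?A + card ((\<lambda>k. k + g) ` ?A)"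
    using partner_closed_decompose[OF assms] by simp
  then show ?thesis by (simp add: card_image)
qed

text \<open>Here \<open>Q S k\<close> abstracts the statement that \<open>e\<^sub>S y\<^sup>k\<close> lies in the given ideal.\<close>

locale pair_rules =
  fixes g n :: nat and Q :: "nat set \<Rightarrow> nat \<Rightarrow> bool" and S0 :: "nat set"
  assumes remove: "\<And>S i k. S \<subseteq> {1..2*g} \<Longrightarrow> i \<in> S \<Longrightarrow> partner g i \<in> S \<Longrightarrow> Q S k
      \<Longrightarrow> Q (S - {partner g i}) (Suc k)"
    and add: "\<And>S i k. S \<subseteq> {1..2*g} \<Longrightarrow> i \<in> {1..2*g} \<Longrightarrow> i \<notin> S \<Longrightarrow> partner g i \<notin> S \<Longrightarrow> Q S k
      \<Longrightarrow> Q (insert i S) k"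
    and lower: "\<And>S i k. S \<subseteq> {1..2*g} \<Longrightarrow> i \<in> {1..2*g} \<Longrightarrow> i \<notin> S \<Longrightarrow> partner g i \<notin> S
      \<Longrightarrow> Q (insert (partner g i) S) k \<Longrightarrow> Q (insert i (insert (partner g i) S)) k \<Longrightarrow> Q S (Suc k)"
    and raise: "\<And>S i k. S \<subseteq> {1..2*g} \<Longrightarrow> i \<in> {1..2*g} \<Longrightarrow> i \<notin> S \<Longrightarrow> partner g i \<notin> S
      \<Longrightarrow> Q (insert (partner g i) S) k \<Longrightarrow> Q S (Suc k) \<Longrightarrow> Q (insert i (insert (partner g i) S)) k"
    and mono: "\<And>S k. S \<subseteq> {1..2*g} \<Longrightarrow> Q S k \<Longrightarrow> Q S (Suc k)"
    and base: "\<And>S. S \<subseteq> {1..2*g} \<Longrightarrow> card S = Suc n \<Longrightarrow> Q S 0"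
    and closed_base: "even n \<Longrightarrow> S0 \<subseteq> {1..2*g} \<and> partner_closed g S0 \<and> card S0 = n \<and> Q S0 1"
    and bound: "n + 2 \<le> 2 * g"
begin

lemma finite_sub: "S \<subseteq> {1..2*g} \<Longrightarrow> finite S"
  using finite_subset by blast

text \<open>Adding one pair by \<open>raise\<close> and deleting another by \<open>lower\<close>
  leads from one union of \<open>n div 2\<close> pairs to a neighbouring one. Each exchange brings
  the set closer to \<open>S'\<close>.\<close>

lemma exchange:
  assumes "S \<subseteq> {1..2*g}" "partner_closed g S" "card S = n" "Q S 1"
    and "S' \<subseteq> {1..2*g}" "partner_closed g S'" "card S' = n"
  shows "Q S' 1"
  using assms
proof (induction "card (S' - S)" arbitrary: S rule: less_induct)
  case less
  have fin: "finite S" "finite S'" using less.prems finite_sub by auto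
  show ?case
  proof (cases "S' \<subseteq> S")
    case True
    then have "S' = S" using less.prems fin by (intro card_subset_eq) auto
    then show ?thesis using less.prems by simp
  next
    case False
    then obtain i where i: "i \<in> S'" "i \<notin> S" by blast
    have "\<not> S \<subseteq> S'" using False less.prems fin card_subset_eq[of S' S] by auto
    then obtain j where j: "j \<in> S" "j \<notin> S'" by blast
    have iN: "i \<in> {1..2*g}" and jN: "j \<in> {1..2*g}" using i j less.prems by auto
    let ?i = "partner g i" and ?j = "partner g j"
    have i': "?i \<in> S'" "?i \<notin> S" and j': "?j \<in> S" "?j \<notin> S'"
      using i j less.prems partner_partner[OF iN] partner_partner[OF jN]
      unfolding partner_closed_def by metis+
    have neq: "?i \<noteq> i" "?j \<noteq> j" "i \<noteq> j" "i \<noteq> ?j" "?i \<noteq> j" "?i \<noteq> ?j"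
      using i j i' j' partner_neq[OF iN] partner_neq[OF jN] by auto
    \<comment> \<open>\<open>i\<close> and its partner are the pair to gain, \<open>j\<close> and
      its partner the pair to lose; \<open>R\<close> contains both and has \<open>n + 2\<close>
      elements.\<close>
    define R where "R = insert i (insert ?i S)"
    define T where "T = R - {j, ?j}"
    have RN: "R \<subseteq> {1..2*g}" using less.prems iN partner_in[OF iN] by (auto simp: R_def)
    have TN: "T \<subseteq> {1..2*g}" using RN by (auto simp: T_def)
    have Tn: "j \<notin> T" "?j \<notin> T" by (auto simp: T_def)
    have cardR: "card R = n + 2" unfolding R_def using less.prems fin i i' neq by simp
    have RT: "insert j (insert ?j T) = R" using j j' by (auto simp: T_def R_def)
    have cardT: "card T = n"
    proof -
      have "card (insert j (insert ?j T)) = card T + 2" using TN Tn neq finite_sub by simp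
      then show ?thesis using RT cardR by simp
    qed
    \<comment> \<open>The intermediate sets \<open>insert ?i S\<close> and
      \<open>insert ?j T\<close> have \<open>n + 1\<close> elements, so \<open>base\<close> applies
      to them.\<close>
    have "Q (insert ?i S) 0"
      using less.prems fin i' partner_in[OF iN] by (intro base) auto
    then have QR: "Q R 0" using raise[of S i 0] less.prems i i' iN by (simp add: R_def)
    have "Q (insert ?j T) 0"
      using TN finite_sub Tn cardT partner_in[OF jN] by (intro base) auto
    then have "Q T 1" using lower[of T j 0] TN jN Tn QR RT by simp
    moreover have "partner_closed g T"
    proof -
      have "partner g x \<in> T" if "x \<in> T" for x
      proof -
        have x: "x \<in> {1..2*g}" "x \<noteq> j" "x \<noteq> ?j" "x \<in> R" using that TN by (auto simp: T_def)
        then have "partner g x \<noteq> ?j" "partner g x \<noteq> j" using jN by (metis partner_partner)+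
        moreover have "partner g x \<in> R"
          using x(4) less.prems(2) iN by (auto simp: R_def partner_closed_def)
        ultimately show ?thesis by (simp add: T_def)
      qed
      then show ?thesis by (simp add: partner_closed_def)
    qed
    moreover have "card (S' - T) < card (S' - S)"
    proof (rule psubset_card_mono)
      show "S' - T \<subset> S' - S" using i j j' by (auto simp: T_def R_def)
    qed (use fin in simp)
    ultimately show ?thesis using less TN cardT by blast
  qed
qed

lemma at_bound:
  assumes S: "S \<subseteq> {1..2*g}" "card S = n"
  shows "Q S 1"
proof (cases "partner_closed g S")
  case True
  then have "even n" using partner_closed_even_card[of S g] S by auto
  then show ?thesis using closed_base exchange[of S0 S] S True by blast
next
  case False
  then obtain i where i: "i \<in> S" "partner g i \<notin> S" by (auto simp: partner_closed_def)
  then have iN: "i \<in> {1..2*g}" using S by auto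
  \<comment> \<open>Adding the missing partner gives a generator. As \<open>i\<close> is already
    present, multiplication by x_i only removes the partner again, at the cost of a factor
    y.\<close>
  have "Q (insert (partner g i) S) 0"
    using S i finite_sub partner_in[OF iN] by (intro base) auto
  then show ?thesis using remove[of "insert (partner g i) S" i 0] S i partner_in[OF iN] by simp
qed

text \<open>Induction on the cardinality. A variable without partner is added by \<open>add\<close>.
  In a union of pairs a whole pair is added by \<open>raise\<close>, whose premise with exponent 1
  comes from \<open>at_bound\<close> or from the induction and \<open>mono\<close>.\<close>

lemma above_bound:
  assumes "S \<subseteq> {1..2*g}" "card S > n"
  shows "Q S 0"
  using assms
proof (induction "card S" arbitrary: S rule: less_induct)
  case less
  have fin: "finite S" using less.prems finite_sub by auto
  show ?case
  proof (cases "card S = Suc n")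
    case True
    then show ?thesis using base less.prems by simp
  next
    case False
    then have big: "card S \<ge> n + 2" using less.prems by simp
    have rem: "Q (S - {i}) 0" if "i \<in> S" for i
    proof (rule less.hyps)
      show "S - {i} \<subseteq> {1..2*g}" using less.prems by auto
    qed (use that big fin in auto)
    show ?thesis
    proof (cases "partner_closed g S")
      case True
      from big obtain i where i: "i \<in> S" by fastforce
      then have iN: "i \<in> {1..2*g}" and i': "partner g i \<in> S"
        using less.prems True by (auto simp: partner_closed_def)
      define T where "T = S - {i, partner g i}"
      have TN: "T \<subseteq> {1..2*g}" using less.prems by (auto simp: T_def)
      have ST: "S = insert i (insert (partner g i) T)" using i i' by (auto simp: T_def)
      have ST': "S - {i} = insert (partner g i) T" using i' partner_neq[OF iN] by (auto simp: T_def)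
      have Tn: "i \<notin> T" "partner g i \<notin> T" by (auto simp: T_def)
      then have card: "card S = card T + 2" using ST TN finite_sub partner_neq[OF iN] by (metis
            card_insert_disjoint finite_insert insert_iff add_2_eq_Suc')
      have "Q T 1"
      proof (cases "card T = n")
        case True
        then show ?thesis using at_bound TN by simp
      next
        case False
        then have "Q T 0" using less.hyps[of T] TN card big by simp
        then show ?thesis using mono TN by fastforce
      qed
      then show ?thesis using raise[of T i 0] TN Tn iN rem[OF i] ST ST' by simp
    next
      case False
      then obtain i where i: "i \<in> S" "partner g i \<notin> S" by (auto simp: partner_closed_def)
      moreover have "S - {i} \<subseteq> {1..2*g}" "i \<in> {1..2*g}" using less.prems i by auto
      moreover have "insert i (S - {i}) = S" using i by auto
      ultimately show ?thesis using add[of "S - {i}" i 0] rem[OF i(1)] by auto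
    qed
  qed
qed

text \<open>Below cardinality \<open>n\<close> the induction descends from larger sets: removing an
  element costs one factor y, which matches the exponent \<open>Suc n - card S\<close>.\<close>

lemma everywhere:
  assumes "S \<subseteq> {1..2*g}"
  shows "Q S (Suc n - card S)"
  using assms
proof (induction "2 * g - card S" arbitrary: S rule: less_induct)
  case less
  have fin: "finite S" using less.prems finite_sub by auto
  consider "card S > n" | "card S = n" | "card S < n" by linarith
  then show ?case
  proof cases
    case 1
    then show ?thesis using above_bound less.prems by simp
  next
    case 2
    then show ?thesis using at_bound less.prems by simp
  next
    case 3
    have ins: "Q (insert i S) (n - card S)" if "i \<in> {1..2*g}" "i \<notin> S" for i
    proof -
      have "card (insert i S) = Suc (card S)" using that fin by simp
      then show ?thesis using less.hyps[of "insert i S"] less.prems that 3 bound by auto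
    qed
    show ?thesis
    proof (cases "partner_closed g S")
      case True
      have "card S < card {1..2*g}" using 3 bound by simp
      then obtain i where i: "i \<in> {1..2*g}" "i \<notin> S"
        using fin card_mono[of S "{1..2*g}"] by (metis not_le subsetI)
      have i': "partner g i \<notin> S" using True i partner_partner[OF i(1)] by (metis partner_closed_def)
      let ?T = "insert i (insert (partner g i) S)"
      have TN: "?T \<subseteq> {1..2*g}" using less.prems i partner_in[OF i(1)] by auto
      have "card ?T = card S + 2" using i i' fin not_sym[OF partner_neq[OF i(1)]] by simp
      \<comment> \<open>This exponent is one below that of \<open>insert (partner g i) S\<close>;
        \<open>lower\<close> needs both equal, hence \<open>mono\<close> follows.\<close>
      then have "Q ?T (Suc n - (card S + 2))"
        using less.hyps[of ?T] TN 3 bound by auto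
      then have "Q ?T (Suc (Suc n - (card S + 2)))" using mono TN by blast
      moreover have "Suc (Suc n - (card S + 2)) = n - card S" using 3 by simp
      ultimately have "Q ?T (n - card S)" by simp
      then have "Q S (Suc (n - card S))"
        using lower[of S i "n - card S"] less.prems i i' ins[of "partner g i"] partner_in[OF i(1)] by blast
      then show ?thesis using 3 by (simp add: Suc_diff_le)
    next
      case False
      then obtain i where i: "i \<in> S" "partner g i \<notin> S" by (auto simp: partner_closed_def)
      have i'N: "partner g i \<in> {1..2*g}" using i less.prems by (intro partner_in) auto
      have "insert (partner g i) S \<subseteq> {1..2*g}" using i'N less.prems by auto
      from remove[OF this, of i "n - card S"] have "Q S (Suc (n - card S))"
        using ins[OF i'N i(2)] i by simp
      then show ?thesis using 3 by (simp add: Suc_diff_le)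
    qed
  qed
qed

end

subsection \<open>The generators in the adapted basis\<close>

abbreviation Y :: "rat poly" where "Y \<equiv> [:0, 1:]"

lemma Y_monom: "Y = monom 1 1"
  by (simp add: monom_altdef)

lemma quantize_inverse:
  assumes "p \<in> carrier (free_gca g)"
  shows "quantize g (- Y) (quantize g Y p) = p"
proof -
  have "quantize g 0 p = p" by (rule quantize_0) (use assms in \<open>unfold free_gca_carrier, blast\<close>)
  then show ?thesis by (simp add: quantize_quantize)
qed

section \<open>Ideals given by divisibility of coordinates\<close>

lemma wedge_carrier:
  "p \<in> carrier (free_gca g) \<Longrightarrow> i \<in> {1..2*g} \<Longrightarrow> wedge i p \<in> carrier (free_gca g)"
  by (simp add: monomial_carrier free_gca_mult_closed flip: monomial_singleton_mult)

lemma monom_dvd_shift: "k \<le> m \<Longrightarrow> monom 1 m dvd p \<Longrightarrow> monom (1::rat) k dvd p"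
  by (auto simp: monom_1_dvd_iff')

lemma monom_dvd_Y_mult: "monom 1 m dvd p \<Longrightarrow> monom (1::rat) (Suc m) dvd Y * p"
  using mult_dvd_mono[of "monom 1 1" Y "monom 1 m" p] by (simp add: Y_monom mult_monom)

text \<open>Prescribes a power of y for each coordinate in (e_S). The Macdonald ideal and the ideals
  that separate a polynomial with \<open>q = 0\<close> from the other generators have this
  form.\<close>

definition weight_ideal :: "nat \<Rightarrow> (nat set \<Rightarrow> nat) \<Rightarrow> (nat set \<Rightarrow> rat poly) set" where
  "weight_ideal g h =
     {p \<in> carrier (free_gca g). \<forall>S\<subseteq>{1..2*g}. monom 1 (h S) dvd quantize g Y p S}"

text \<open>The two conditions on \<open>h\<close> match the two terms of \<open>clifford\<close>:
  adding a variable must not raise the required power, and removing one may raise it only by the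
  factor y that comes with the contraction.\<close>

lemma weight_ideal_stable:
  assumes h: "\<And>S i. S \<subseteq> {1..2*g} \<Longrightarrow> i \<in> {1..2*g} \<Longrightarrow> i \<notin> S
      \<Longrightarrow> h (insert i S) \<le> h S \<and> h S \<le> Suc (h (insert i S))"
  shows "gca_stable g (weight_ideal g h)"
  unfolding gca_stable_def
proof (intro conjI ballI allI)
  show "weight_ideal g h \<subseteq> carrier (free_gca g)" by (auto simp: weight_ideal_def)
  have "quantize g Y (\<lambda>_. 0) = (\<lambda>_. 0)" by (simp add: quantize_def)
  then show "(\<lambda>_. 0) \<in> weight_ideal g h" by (auto simp: weight_ideal_def free_gca_carrier)
next
  fix p q assume "p \<in> weight_ideal g h" "q \<in> weight_ideal g h"
  then show "(\<lambda>U. p U + q U) \<in> weight_ideal g h"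
    by (auto simp: weight_ideal_def free_gca_carrier quantize_add)
next
  fix r p assume "p \<in> weight_ideal g h"
  then show "(\<lambda>U. r * p U) \<in> weight_ideal g h"
    by (auto simp: weight_ideal_def free_gca_carrier quantize_scale)
next
  fix p assume p: "p \<in> weight_ideal g h"
  show "parity p \<in> weight_ideal g h"
    unfolding weight_ideal_def
  proof (intro CollectI conjI allI impI)
    show "parity p \<in> carrier (free_gca g)"
      using p by (auto simp: weight_ideal_def free_gca_carrier parity_def)
    fix S assume S: "S \<subseteq> {1..2*g}"
    then have "finite S" using finite_subset by blast
    then show "monom 1 (h S) dvd quantize g Y (parity p) S"
      using p S by (simp add: weight_ideal_def quantize_parity) (simp add: parity_def)
  qed
next
  fix i p assume i: "i \<in> {1..2*g}" and p: "p \<in> weight_ideal g h"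
  let ?j = "partner g i" and ?c = "quantize g Y p"
  have j: "?j \<in> {1..2*g}" using i by (rule partner_in)
  have c: "S \<subseteq> {1..2*g} \<Longrightarrow> monom 1 (h S) dvd ?c S" for S using p by (simp add: weight_ideal_def)
  show "wedge i p \<in> weight_ideal g h"
    unfolding weight_ideal_def
  proof (intro CollectI conjI allI impI)
    show "wedge i p \<in> carrier (free_gca g)" using p i by (simp add: weight_ideal_def wedge_carrier)
    fix S assume S: "S \<subseteq> {1..2*g}"
    have "monom 1 (h S) dvd wedge i ?c S"
    proof (cases "i \<in> S")
      case True
      then have "h S \<le> h (S - {i})" using h[of "S - {i}" i] S i by (auto simp: insert_absorb)
      moreover have "monom 1 (h (S - {i})) dvd ?c (S - {i})" using S by (intro c) auto
      ultimately show ?thesis by (simp add: wedge_def monom_dvd_shift)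
    qed (simp add: wedge_def)
    moreover have "monom 1 (h S) dvd Y * orient g i * contract ?j ?c S"
    proof (cases "?j \<in> S")
      case False
      have "monom 1 (h (insert ?j S)) dvd ?c (insert ?j S)" using S j by (intro c) auto
      then have "monom 1 (Suc (h (insert ?j S))) dvd Y * ?c (insert ?j S)" by (rule monom_dvd_Y_mult)
      then have "monom 1 (h S) dvd Y * ?c (insert ?j S)"
        using h[OF S j False] by (blast intro: monom_dvd_shift)
      then have "monom 1 (h S) dvd (Y * ?c (insert ?j S)) * (orient g i * sg ?j S)" by (rule dvd_mult2)
      then show ?thesis using False by (simp only: contract_def if_False mult_ac)
    qed (simp add: contract_def)
    ultimately show "monom 1 (h S) dvd quantize g Y (wedge i p) S"
      unfolding quantize_wedge[OF i] clifford_def by (rule dvd_add)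
  qed
qed

text \<open>The truncated subtraction puts no condition on sets with more than \<open>n\<close>
  elements.\<close>

lemma macdonald_ideal_weight: "macdonald_ideal g n = weight_ideal g (\<lambda>S. Suc n - card S)"
proof -
  have "q < Suc n - card S \<longleftrightarrow> card S + q \<le> n" for S q by auto
  then show ?thesis
    by (auto simp: macdonald_ideal_iff weight_ideal_def monom_1_dvd_iff')
qed

lemma card_weight:
  fixes g i :: nat
  assumes "S \<subseteq> {1..2*g}" "i \<notin> S"
  shows "card (insert i S) = Suc (card S)"
  using assms finite_subset[OF assms(1)] by simp

lemma macdonald_ideal_stable: "gca_stable g (macdonald_ideal g n)"
  unfolding macdonald_ideal_weight by (rule weight_ideal_stable) (auto simp: card_weight)

text \<open>In adapted coordinates the polynomials with \<open>q = 0\<close> have this form. Leaving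
  the sign open avoids computing it for each product.\<close>

definition signed_monomial :: "nat set \<Rightarrow> (nat set \<Rightarrow> rat poly) \<Rightarrow> bool" where
  "signed_monomial S c \<longleftrightarrow> (\<exists>\<epsilon>\<in>{1, -1}. c = (\<lambda>U. \<epsilon> * monomial S U))"

lemma signed_monomialE:
  assumes "signed_monomial S c"
  obtains \<epsilon> where "\<epsilon> \<in> {1, -1}" "c = (\<lambda>U. \<epsilon> * monomial S U)"
  using assms unfolding signed_monomial_def by blast

lemma signed_monomial_unique:
  assumes "signed_monomial S c" "signed_monomial T c"
  shows "S = T"
proof (rule ccontr)
  assume "S \<noteq> T"
  obtain \<epsilon> where \<epsilon>: "\<epsilon> \<in> {1, -1}" "c = (\<lambda>U. \<epsilon> * monomial S U)"
    using assms(1) by (rule signed_monomialE)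
  obtain \<delta> where \<delta>: "c = (\<lambda>U. \<delta> * monomial T U)"
    using assms(2) by (blast elim: signed_monomialE)
  have "c S = \<epsilon>" unfolding \<epsilon>(2) by (simp add: monomial_def)
  moreover have "c S = 0" unfolding \<delta> using \<open>S \<noteq> T\<close> by (simp add: monomial_def)
  ultimately have "\<epsilon> = 0" by simp
  then show False using \<epsilon>(1) by auto
qed

lemma sg_cases: "sg i S \<in> {1, -1}"
  by (cases "even (card {t \<in> S. t < i})") (simp_all add: sg_def)

lemma signed_monomial_scale:
  "\<delta> \<in> {1, -1} \<Longrightarrow> \<epsilon> \<in> {1, -1} \<Longrightarrow> signed_monomial S (\<lambda>U. \<delta> * (\<epsilon> * monomial S U))"
  unfolding signed_monomial_def by (intro bexI[of _ "\<delta> * \<epsilon>"]) (auto simp: mult.assoc)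

lemma clifford_signed_monomial:
  assumes "i \<notin> T" "partner g i \<notin> T" "signed_monomial T c"
  shows "signed_monomial (insert i T) (clifford g Y i c)"
proof -
  obtain \<epsilon> where \<epsilon>: "\<epsilon> \<in> {1, -1}" and c: "c = (\<lambda>U. \<epsilon> * monomial T U)"
    using assms(3) by (rule signed_monomialE)
  have "clifford g Y i c = (\<lambda>U. \<epsilon> * (sg i T * monomial (insert i T) U))"
    using assms(1,2) unfolding c clifford_scale[abs_def] clifford_def
    by (simp add: wedge_monomial contract_monomial)
  then show ?thesis using \<epsilon> sg_cases signed_monomial_scale by metis
qed

text \<open>Multiplication by z_k. The term that arises by contracting \<open>k + g\<close> is y
  times \<open>c\<close>, so the subtraction cancels it and only the set enlarged by the pair
  remains.\<close>

lemma clifford_pair_signed_monomial: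
  assumes k: "k \<in> {1..g}" "k \<notin> T" "k + g \<notin> T" and c: "signed_monomial T c"
  shows "signed_monomial (insert k (insert (k + g) T))
    (\<lambda>U. Y * c U - clifford g Y k (clifford g Y (k + g) c) U)"
proof -
  obtain \<epsilon> where \<epsilon>: "\<epsilon> \<in> {1, -1}" and c: "c = (\<lambda>U. \<epsilon> * monomial T U)"
    using c by (rule signed_monomialE)
  have p: "partner g k = k + g" "partner g (k + g) = k" and o: "orient g k = (1 :: rat poly)"
    using k by (auto simp: partner_def orient_def)
  let ?a = "sg (k + g) T :: rat poly" and ?b = "sg k (insert (k + g) T) :: rat poly"
  have 1: "clifford g Y (k + g) (monomial T) = (\<lambda>U. ?a * monomial (insert (k + g) T) U)"
    using k unfolding clifford_def p by (simp add: wedge_monomial contract_monomial)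
  have 2: "clifford g Y k (monomial (insert (k + g) T))
     = (\<lambda>U. ?b * monomial (insert k (insert (k + g) T)) U + Y * (?a * monomial T U))"
    using k unfolding clifford_def p o
    by (simp add: wedge_monomial contract_monomial sg_insert)
  have "clifford g Y k (clifford g Y (k + g) c) U
     = \<epsilon> * (?a * (?b * monomial (insert k (insert (k + g) T)) U)) + Y * (\<epsilon> * monomial T U)" for U
  proof -
    have "clifford g Y k (clifford g Y (k + g) c) U = \<epsilon> * (?a * clifford g Y k (monomial (insert (k + g) T)) U)"
      unfolding c clifford_scale[abs_def] 1 ..
    then show ?thesis unfolding 2 by (simp only: distrib_left mult.left_commute[of ?a Y] sg_sq_left mult.left_commute[of \<epsilon> Y])
  qed
  then have "(\<lambda>U. Y * c U - clifford g Y k (clifford g Y (k + g) c) U)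
     = (\<lambda>U. (- (\<epsilon> * ?a)) * (?b * monomial (insert k (insert (k + g) T)) U))"
    by (simp add: c algebra_simps)
  moreover have "- (\<epsilon> * ?a) \<in> {1, -1}" using \<epsilon> sg_cases[of "k + g" T] by auto
  ultimately show ?thesis using sg_cases signed_monomial_scale by metis
qed

lemma var_x_monomial: "var_x i = monomial {i}" and var_x'_monomial: "var_x' g i = monomial {i + g}"
  and var_y_monomial: "var_y = (\<lambda>U. Y * monomial {} U)"
  by (auto simp: var_x_def var_x'_def var_y_def monomial_def)

lemma y_minus_xx'_mult:
  assumes p: "p \<in> carrier (free_gca g)" and k: "k \<in> {1..g}"
  shows "y_minus_xx' g k \<otimes>\<^bsub>free_gca g\<^esub> p = (\<lambda>U. Y * p U - wedge k (wedge (k + g) p) U)"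
    and "y_minus_xx' g k \<in> carrier (free_gca g)"
proof -
  interpret ring "free_gca g" by (rule free_gca_ring)
  have c: "monomial {k} \<in> carrier (free_gca g)" "monomial {k + g} \<in> carrier (free_gca g)"
    using k by (auto intro!: monomial_carrier)
  have y: "var_y \<in> carrier (free_gca g)" unfolding var_y_monomial by (rule scalar_carrier)
  show "y_minus_xx' g k \<in> carrier (free_gca g)"
    unfolding y_minus_xx'_def var_x_monomial var_x'_monomial using c y by simp
  have wp: "wedge (k + g) p \<in> carrier (free_gca g)" using k by (intro wedge_carrier[OF p]) auto
  then have wwp: "wedge k (wedge (k + g) p) \<in> carrier (free_gca g)" using wedge_carrier[OF wp, of k] k by auto
  have "y_minus_xx' g k \<otimes>\<^bsub>free_gca g\<^esub> p
     = var_y \<otimes>\<^bsub>free_gca g\<^esub> p \<ominus>\<^bsub>free_gca g\<^esub> (monomial {k} \<otimes>\<^bsub>free_gca g\<^esub> (monomial {k + g} \<otimes>\<^bsub>free_gca g\<^esub> p))"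
    unfolding y_minus_xx'_def var_x_monomial var_x'_monomial
    using c y p by (simp add: minus_eq l_distr l_minus m_assoc)
  also have "\<dots> = (\<lambda>U. Y * p U - wedge k (wedge (k + g) p) U)"
    unfolding monomial_singleton_mult[OF p] monomial_singleton_mult[OF wp] free_gca_a_minus[OF wwp]
      var_y_monomial scalar_mult(1)[OF p] ..
  finally show "y_minus_xx' g k \<otimes>\<^bsub>free_gca g\<^esub> p = (\<lambda>U. Y * p U - wedge k (wedge (k + g) p) U)" .
qed

lemma quantize_y_minus_xx'_mult:
  assumes p: "p \<in> carrier (free_gca g)" and k: "k \<in> {1..g}"
  shows "quantize g Y (y_minus_xx' g k \<otimes>\<^bsub>free_gca g\<^esub> p)
    = (\<lambda>U. Y * quantize g Y p U - clifford g Y k (clifford g Y (k + g) (quantize g Y p)) U)"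
proof -
  have kN: "k \<in> {1..2*g}" "k + g \<in> {1..2*g}" using k by auto
  have "y_minus_xx' g k \<otimes>\<^bsub>free_gca g\<^esub> p
     = (\<lambda>U. (\<lambda>U. Y * p U) U + (\<lambda>U. (-1) * wedge k (wedge (k + g) p) U) U)"
    unfolding y_minus_xx'_mult(1)[OF p k] by simp
  then have "quantize g Y (y_minus_xx' g k \<otimes>\<^bsub>free_gca g\<^esub> p) U
     = Y * quantize g Y p U + (-1) * quantize g Y (wedge k (wedge (k + g) p)) U" for U
    by (simp only: quantize_add quantize_scale)
  then show ?thesis using kN by (auto simp: quantize_wedge)
qed

text \<open>Stated for an arbitrary last factor \<open>p\<close>, later the product of the z_k. No
  variable meets its partner, so every contraction term vanishes.\<close>

lemma signed_monomial_prod_x: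
  assumes "distinct xs" "set xs \<subseteq> {1..2*g}" "\<And>i. i \<in> set xs \<Longrightarrow> partner g i \<notin> set xs"
    "set xs \<inter> T = {}" "partner g ` set xs \<inter> T = {}"
    "p \<in> carrier (free_gca g)" "signed_monomial T (quantize g Y p)"
  shows "foldr (\<lambda>a b. a \<otimes>\<^bsub>free_gca g\<^esub> b) (map (\<lambda>i. monomial {i}) xs) p \<in> carrier (free_gca g) \<and>
    signed_monomial (set xs \<union> T)
      (quantize g Y (foldr (\<lambda>a b. a \<otimes>\<^bsub>free_gca g\<^esub> b) (map (\<lambda>i. monomial {i}) xs) p))"
  using assms
proof (induction xs)
  case (Cons i xs)
  let ?q = "foldr (\<lambda>a b. a \<otimes>\<^bsub>free_gca g\<^esub> b) (map (\<lambda>i. monomial {i}) xs) p"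
  have IH: "?q \<in> carrier (free_gca g)" "signed_monomial (set xs \<union> T) (quantize g Y ?q)"
    using Cons.IH Cons.prems by auto
  have i: "i \<in> {1..2*g}" using Cons.prems by simp
  have "partner g i \<notin> set (i # xs)" using Cons.prems by simp
  then have "i \<notin> set xs \<union> T" "partner g i \<notin> set xs \<union> T" using Cons.prems by auto
  from clifford_signed_monomial[OF this IH(2)] show ?case
    using i IH(1) by (simp add: monomial_singleton_mult wedge_carrier quantize_wedge)
qed simp

lemma signed_monomial_prod_z:
  assumes "distinct ks" "set ks \<subseteq> {1..g}"
  shows "list_prod (free_gca g) (map (y_minus_xx' g) ks) \<in> carrier (free_gca g) \<and>
    signed_monomial (set ks \<union> (\<lambda>k. k + g) ` set ks)
      (quantize g Y (list_prod (free_gca g) (map (y_minus_xx' g) ks)))"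
  using assms
proof (induction ks)
  case Nil
  have "quantize g Y (monomial {}) = monomial {}" by (simp add: quantize_monomial)
  then show ?case
    by (auto simp: list_prod_def free_gca_one monomial_carrier signed_monomial_def)
next
  case (Cons k ks)
  let ?q = "list_prod (free_gca g) (map (y_minus_xx' g) ks)" and ?T = "set ks \<union> (\<lambda>k. k + g) ` set ks"
  have IH: "?q \<in> carrier (free_gca g)" "signed_monomial ?T (quantize g Y ?q)"
    using Cons.IH Cons.prems by auto
  have k: "k \<in> {1..g}" using Cons.prems by simp
  have "k \<notin> ?T" "k + g \<notin> ?T" using Cons.prems by auto
  from clifford_pair_signed_monomial[OF k this IH(2)]
  have "signed_monomial (insert k (insert (k + g) ?T))
    (quantize g Y (y_minus_xx' g k \<otimes>\<^bsub>free_gca g\<^esub> ?q))"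
    unfolding quantize_y_minus_xx'_mult[OF IH(1) k] .
  moreover have "list_prod (free_gca g) (map (y_minus_xx' g) (k # ks)) = y_minus_xx' g k \<otimes>\<^bsub>free_gca g\<^esub> ?q"
    by (simp add: list_prod_def)
  moreover have "insert k (insert (k + g) ?T) = set (k # ks) \<union> (\<lambda>k. k + g) ` set (k # ks)" by auto
  ultimately show ?case
    using free_gca_mult_closed[OF y_minus_xx'_mult(2)[OF IH(1) k] IH(1)] by simp
qed

section \<open>The generators indexed by sets of odd variables\<close>

lemma shift_disjoint:
  fixes A B :: "nat set"
  assumes "A \<subseteq> {1..g}" "B \<subseteq> {1..g}"
  shows "A \<inter> (\<lambda>k. k + g) ` B = {}"
proof -
  have "k + g \<notin> A" if "k \<in> B" for k using subsetD[OF assms(2) that] assms(1) by auto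
  then show ?thesis by auto
qed

text \<open>The set \<open>S\<close> for which the polynomial given by \<open>I\<close>,
  \<open>J\<close>, \<open>K\<close> is e_S up to sign; a factor z_k counts as the pair
  \<open>k\<close>, \<open>k + g\<close>.\<close>

definition index_set :: "nat \<Rightarrow> nat set \<Rightarrow> nat set \<Rightarrow> nat set \<Rightarrow> nat set" where
  "index_set g I J K = I \<union> (\<lambda>j. j + g) ` J \<union> (K \<union> (\<lambda>k. k + g) ` K)"

lemma signed_monomial_macdonald_poly:
  assumes "I \<subseteq> {1..g}" "J \<subseteq> {1..g}" "K \<subseteq> {1..g}" "I \<inter> J = {}" "I \<inter> K = {}" "J \<inter> K = {}"
  shows "macdonald_poly g I J K \<in> carrier (free_gca g)"
    and "signed_monomial (index_set g I J K) (quantize g Y (macdonald_poly g I J K))"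
proof -
  let ?mult = "foldr (\<lambda>a b. a \<otimes>\<^bsub>free_gca g\<^esub> b)"
  let ?z = "list_prod (free_gca g) (map (y_minus_xx' g) (sorted_list_of_set K))"
  let ?xs = "sorted_list_of_set I @ map (\<lambda>j. j + g) (sorted_list_of_set J)"
  have fin: "finite I" "finite J" "finite K" using assms by (meson finite_atLeastAtMost finite_subset)+
  have z: "?z \<in> carrier (free_gca g)" "signed_monomial (K \<union> (\<lambda>k. k + g) ` K) (quantize g Y ?z)"
    using signed_monomial_prod_z[of "sorted_list_of_set K" g] fin assms by auto
  have set: "set ?xs = I \<union> (\<lambda>j. j + g) ` J" using fin by simp
  have eq: "macdonald_poly g I J K = ?mult (map (\<lambda>i. monomial {i}) ?xs) ?z"
    by (simp add: macdonald_poly_def list_prod_def var_x_monomial[abs_def] var_x'_monomial[abs_def] o_def)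
  have "?mult (map (\<lambda>i. monomial {i}) ?xs) ?z \<in> carrier (free_gca g) \<and>
    signed_monomial (set ?xs \<union> (K \<union> (\<lambda>k. k + g) ` K)) (quantize g Y (?mult (map (\<lambda>i. monomial {i}) ?xs) ?z))"
  proof (rule signed_monomial_prod_x[OF _ _ _ _ _ z])
    show "distinct ?xs" using shift_disjoint[OF assms(1,2)] fin by (simp add: distinct_map)
    show "set ?xs \<subseteq> {1..2*g}" unfolding set using assms by auto
    have p: "i \<in> I \<Longrightarrow> partner g i = i + g" "j \<in> J \<Longrightarrow> partner g (j + g) = j" for i j
      using assms by (auto simp: partner_def)
    show "partner g i \<notin> set ?xs" if "i \<in> set ?xs" for i
    proof -
      have "x \<in> I \<Longrightarrow> x + g \<notin> I" "x \<in> J \<Longrightarrow> x + g \<notin> J" for x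
        using shift_disjoint[OF assms(1,1)] shift_disjoint[OF assms(2,2)] by auto
      then show ?thesis using that assms(4) p unfolding set by auto
    qed
    show "set ?xs \<inter> (K \<union> (\<lambda>k. k + g) ` K) = {}" using assms unfolding set by fastforce
    show "partner g ` set ?xs \<inter> (K \<union> (\<lambda>k. k + g) ` K) = {}"
      using assms p unfolding set by fastforce
  qed
  then show "macdonald_poly g I J K \<in> carrier (free_gca g)"
    "signed_monomial (index_set g I J K) (quantize g Y (macdonald_poly g I J K))"
    unfolding eq set index_set_def by auto
qed

definition pairs_of :: "nat \<Rightarrow> nat set \<Rightarrow> nat set" where
  "pairs_of g S = {k \<in> {1..g}. k \<in> S \<and> k + g \<in> S}"

text \<open>Full pairs in \<open>S\<close> give \<open>K\<close>, unpaired variables give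
  \<open>I\<close> and \<open>J\<close>. With this indexing the count of generators is a binomial
  coefficient.\<close>

definition set_poly :: "nat \<Rightarrow> nat set \<Rightarrow> nat set \<Rightarrow> rat poly" where
  "set_poly g S = macdonald_poly g (S \<inter> {1..g} - pairs_of g S)
     ({j \<in> {1..g}. j + g \<in> S} - pairs_of g S) (pairs_of g S)"

lemma index_set_decompose:
  assumes "S \<subseteq> {1..2*g}"
  shows "index_set g (S \<inter> {1..g} - pairs_of g S) ({j \<in> {1..g}. j + g \<in> S} - pairs_of g S) (pairs_of g S) = S"
proof -
  have "x \<in> (\<lambda>j. j + g) ` {j \<in> {1..g}. j + g \<in> S}" if "x \<in> S" "x \<notin> {1..g}" for x
    using that assms by (intro image_eqI[of _ _ "x - g"]) auto
  then have S: "(S \<inter> {1..g}) \<union> (\<lambda>j. j + g) ` {j \<in> {1..g}. j + g \<in> S} = S" by blast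
  have "index_set g I J K = (I \<union> K) \<union> (\<lambda>j. j + g) ` (J \<union> K)" for I J K
    unfolding index_set_def by blast
  moreover have "(S \<inter> {1..g} - pairs_of g S) \<union> pairs_of g S = S \<inter> {1..g}"
    "({j \<in> {1..g}. j + g \<in> S} - pairs_of g S) \<union> pairs_of g S = {j \<in> {1..g}. j + g \<in> S}"
    unfolding pairs_of_def by blast+
  ultimately show ?thesis using S by simp
qed

lemma card_index_set:
  assumes "I \<subseteq> {1..g}" "J \<subseteq> {1..g}" "K \<subseteq> {1..g}" "I \<inter> J = {}" "I \<inter> K = {}" "J \<inter> K = {}"
  shows "card (index_set g I J K) = card I + card J + 2 * card K"
proof -
  have fin: "finite I" "finite J" "finite K" using assms by (meson finite_atLeastAtMost finite_subset)+
  note disj = shift_disjoint[OF assms(1,2)] shift_disjoint[OF assms(1,3)]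
    shift_disjoint[OF assms(3,2)] shift_disjoint[OF assms(3,3)]
  have 1: "card (K \<union> (\<lambda>k. k + g) ` K) = card K + card ((\<lambda>k. k + g) ` K)"
    using fin disj by (intro card_Un_disjoint) auto
  have 2: "card (I \<union> (\<lambda>j. j + g) ` J) = card I + card ((\<lambda>j. j + g) ` J)"
    using fin disj by (intro card_Un_disjoint) auto
  have "(\<lambda>j. j + g) ` J \<inter> (\<lambda>k. k + g) ` K = {}" using assms(6) by auto
  then have "card (index_set g I J K) = card (I \<union> (\<lambda>j. j + g) ` J) + card (K \<union> (\<lambda>k. k + g) ` K)"
    unfolding index_set_def using fin disj assms(5)
    by (intro card_Un_disjoint) (simp_all add: Int_Un_distrib Int_Un_distrib2 Int_commute)
  then show ?thesis unfolding 1 2 by (simp add: card_image)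
qed

lemma index_set_inverse:
  assumes "I \<subseteq> {1..g}" "J \<subseteq> {1..g}" "K \<subseteq> {1..g}" "I \<inter> J = {}" "I \<inter> K = {}" "J \<inter> K = {}"
  defines "S \<equiv> index_set g I J K"
  shows "pairs_of g S = K" "S \<inter> {1..g} - pairs_of g S = I"
    "{j \<in> {1..g}. j + g \<in> S} - pairs_of g S = J"
proof -
  have 1: "S \<inter> {1..g} = I \<union> K" using assms(1-6) unfolding S_def index_set_def by fastforce
  have 2: "{j \<in> {1..g}. j + g \<in> S} = J \<union> K"
    using assms(1-6) unfolding S_def index_set_def by fastforce
  have "pairs_of g S = (S \<inter> {1..g}) \<inter> {j \<in> {1..g}. j + g \<in> S}" by (auto simp: pairs_of_def)
  then show 3: "pairs_of g S = K" unfolding 1 2 using assms(4-6) by auto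
  show "S \<inter> {1..g} - pairs_of g S = I" "{j \<in> {1..g}. j + g \<in> S} - pairs_of g S = J"
    unfolding 1 2 3 using assms(4-6) by auto
qed

lemma set_poly:
  assumes "S \<subseteq> {1..2*g}"
  shows "set_poly g S \<in> carrier (free_gca g)" "signed_monomial S (quantize g Y (set_poly g S))"
proof -
  have *: "S \<inter> {1..g} - pairs_of g S \<subseteq> {1..g}" "{j \<in> {1..g}. j + g \<in> S} - pairs_of g S \<subseteq> {1..g}"
    "pairs_of g S \<subseteq> {1..g}"
    "(S \<inter> {1..g} - pairs_of g S) \<inter> ({j \<in> {1..g}. j + g \<in> S} - pairs_of g S) = {}"
    "(S \<inter> {1..g} - pairs_of g S) \<inter> pairs_of g S = {}"
    "({j \<in> {1..g}. j + g \<in> S} - pairs_of g S) \<inter> pairs_of g S = {}"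
    by (auto simp: pairs_of_def)
  show "set_poly g S \<in> carrier (free_gca g)" "signed_monomial S (quantize g Y (set_poly g S))"
    using signed_monomial_macdonald_poly[OF *] unfolding index_set_decompose[OF assms] set_poly_def by auto
qed

text \<open>\<open>index_set\<close> and the decomposition in \<open>set_poly\<close> are inverse to
  each other, and \<open>card_index_set\<close> turns the degree condition into a
  cardinality.\<close>

lemma macdonald_polys_eq:
  "macdonald_polys g n = set_poly g ` {S. S \<subseteq> {1..2*g} \<and> card S = Suc n}" (is "?A = ?B")
proof
  show "?A \<subseteq> ?B"
  proof
    fix p assume "p \<in> ?A"
    then obtain I J K where p: "p = macdonald_poly g I J K"
      and *: "I \<subseteq> {1..g}" "J \<subseteq> {1..g}" "K \<subseteq> {1..g}" "I \<inter> J = {}" "I \<inter> K = {}" "J \<inter> K = {}"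
      and card: "card I + card J + 2 * card K = n + 1"
      unfolding macdonald_polys_def by blast
    have "p = set_poly g (index_set g I J K)"
      by (simp only: p set_poly_def index_set_inverse(2,3)[OF *]) (simp only: index_set_inverse(1)[OF *])
    moreover have "index_set g I J K \<subseteq> {1..2*g}" using *(1-3) unfolding index_set_def by fastforce
    ultimately show "p \<in> ?B" using card card_index_set[OF *] by auto
  qed
  show "?B \<subseteq> ?A"
  proof
    fix p assume "p \<in> ?B"
    then obtain S where p: "p = set_poly g S" and S: "S \<subseteq> {1..2*g}" "card S = Suc n" by blast
    let ?I = "S \<inter> {1..g} - pairs_of g S" and ?J = "{j \<in> {1..g}. j + g \<in> S} - pairs_of g S"
      and ?K = "pairs_of g S"
    have *: "?I \<subseteq> {1..g}" "?J \<subseteq> {1..g}" "?K \<subseteq> {1..g}" "?I \<inter> ?J = {}" "?I \<inter> ?K = {}" "?J \<inter> ?K = {}"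
      by (auto simp: pairs_of_def)
    have "card ?I + card ?J + 2 * card ?K = n + 1"
      using card_index_set[OF *] S(2) unfolding index_set_decompose[OF S(1)] by simp
    then show "p \<in> ?A" unfolding macdonald_polys_def p set_poly_def using * by blast
  qed
qed

lemma set_poly_inj:
  assumes "S \<subseteq> {1..2*g}" "T \<subseteq> {1..2*g}" "set_poly g S = set_poly g T"
  shows "S = T"
  using assms set_poly(2) signed_monomial_unique by metis

lemma card_macdonald_polys: "card (macdonald_polys g n) = (2 * g) choose (n + 1)"
proof -
  have "inj_on (set_poly g) {S. S \<subseteq> {1..2*g} \<and> card S = Suc n}"
    by (rule inj_onI) (use set_poly_inj in blast)
  then show ?thesis unfolding macdonald_polys_eq by (simp add: card_image n_subsets)
qed

lemma signed_monomial_weight_ideal: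
  assumes p: "p \<in> carrier (free_gca g)" and c: "quantize g Y p = (\<lambda>U. r * c U)" "signed_monomial S c"
    and r: "monom 1 (h S) dvd r"
  shows "p \<in> weight_ideal g h"
proof -
  obtain \<epsilon> where "c = (\<lambda>U. \<epsilon> * monomial S U)" using c(2) by (blast elim: signed_monomialE)
  then have "quantize g Y p T = (if T = S then r * \<epsilon> else 0)" for T
    by (simp add: c(1) monomial_def)
  then show ?thesis using p r by (auto simp: weight_ideal_def)
qed

text \<open>The coordinate at \<open>S\<close> is 1 or -1, hence not divisible by y.\<close>

lemma not_in_weight_ideal:
  assumes "S \<subseteq> {1..2*g}" "signed_monomial S (quantize g Y p)" "h S > 0"
  shows "p \<notin> weight_ideal g h"
proof
  assume "p \<in> weight_ideal g h"
  then have "monom 1 (h S) dvd quantize g Y p S" using assms(1) by (simp add: weight_ideal_def)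
  moreover obtain \<epsilon> where "\<epsilon> \<in> {1, -1}" "quantize g Y p = (\<lambda>U. \<epsilon> * monomial S U)"
    using assms(2) by (rule signed_monomialE)
  ultimately have "monom 1 (h S) dvd (1 :: rat poly)" by (auto simp: monomial_def)
  then have "coeff (1 :: rat poly) 0 = 0" using assms(3) by (simp only: monom_1_dvd_iff')
  then show False by simp
qed

text \<open>For the union \<open>S\<close> of the first \<open>n div 2\<close> pairs the polynomial
  is y e_S up to sign. The last claim is its value at x = x' = 0, used for irredundancy.\<close>

lemma extra_poly:
  assumes n: "even n" "n + 2 \<le> 2 * g"
  defines "K \<equiv> {1..n div 2}"
  defines "S \<equiv> K \<union> (\<lambda>k. k + g) ` K"
  shows "extra_poly g n \<in> carrier (free_gca g)" "S \<subseteq> {1..2*g}" "card S = n" "partner_closed g S"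
    "\<exists>c. signed_monomial S c \<and> quantize g Y (extra_poly g n) = (\<lambda>U. Y * c U)"
    "extra_poly g n {} = monom 1 (Suc (n div 2))"
proof -
  have Kg: "K \<subseteq> {1..g}" and fin: "finite K" using n unfolding K_def by auto
  then show "S \<subseteq> {1..2*g}" unfolding S_def by fastforce
  have "card S = card K + card ((\<lambda>k. k + g) ` K)"
    unfolding S_def using shift_disjoint[OF Kg Kg] fin by (intro card_Un_disjoint) auto
  moreover have "n div 2 + n div 2 = n" using n(1) by presburger
  ultimately show "card S = n" by (simp add: card_image K_def)
  show "partner_closed g S"
    using Kg unfolding partner_closed_def S_def partner_def by fastforce
  let ?q = "list_prod (free_gca g) (map (y_minus_xx' g) [1..<n div 2 + 1])"
  have set: "set [1..<n div 2 + 1] = K" by (auto simp: K_def)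
  have q: "?q \<in> carrier (free_gca g)" "signed_monomial S (quantize g Y ?q)"
    using signed_monomial_prod_z[of "[1..<n div 2 + 1]" g] Kg unfolding set S_def by auto
  have eq: "extra_poly g n = (\<lambda>U. Y * ?q U)"
    unfolding extra_poly_def var_y_monomial using scalar_mult(2)[OF q(1)] .
  show "extra_poly g n \<in> carrier (free_gca g)"
    using q(1) unfolding eq by (simp add: free_gca_carrier)
  have "quantize g Y (extra_poly g n) = (\<lambda>U. Y * quantize g Y ?q U)"
    unfolding eq by (rule ext) (rule quantize_scale)
  then show "\<exists>c. signed_monomial S c \<and> quantize g Y (extra_poly g n) = (\<lambda>U. Y * c U)"
    using q(2) by blast
  \<comment> \<open>At the empty set the part x_k x'_k of a factor contributes nothing, so each
    factor multiplies by y.\<close>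
  have "set ks \<subseteq> {1..g} \<Longrightarrow> list_prod (free_gca g) (map (y_minus_xx' g) ks) \<in> carrier (free_gca g)
      \<and> list_prod (free_gca g) (map (y_minus_xx' g) ks) {} = Y ^ length ks" for ks
  proof (induction ks)
    case Nil
    show ?case by (simp add: list_prod_def free_gca_one monomial_carrier) (simp add: monomial_def)
  next
    case (Cons k ks)
    let ?q = "list_prod (free_gca g) (map (y_minus_xx' g) ks)"
    have k: "k \<in> {1..g}" and IH: "?q \<in> carrier (free_gca g)" "?q {} = Y ^ length ks" using Cons by auto
    have "list_prod (free_gca g) (map (y_minus_xx' g) (k # ks)) = y_minus_xx' g k \<otimes>\<^bsub>free_gca g\<^esub> ?q"
      by (simp add: list_prod_def)
    then show ?case
      using free_gca_mult_closed[OF y_minus_xx'_mult(2)[OF IH(1) k] IH(1)]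
      unfolding y_minus_xx'_mult(1)[OF IH(1) k] by (simp add: IH(2) wedge_def)
  qed
  from this[of "[1..<n div 2 + 1]"] have "?q {} = Y ^ (n div 2)" using Kg unfolding set by simp
  then show "extra_poly g n {} = monom 1 (Suc (n div 2))"
    unfolding eq by (simp add: monom_altdef)
qed

text \<open>\<open>clifford g (- Y)\<close> maps blades to signed blades or 0; solving its
  definition for \<open>wedge\<close> gives the rule for x_i e_S.\<close>

lemma wedge_cblade:
  assumes "S \<subseteq> {1..2*g}" "i \<in> {1..2*g}"
  shows "wedge i (cblade g (- Y) S) U = (if i \<in> S then 0 else sg i S * cblade g (- Y) (insert i S) U)
    + (if partner g i \<in> S
       then Y * (orient g i * sg (partner g i) S * cblade g (- Y) (S - {partner g i}) U) else 0)"
proof -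
  have "finite S" using assms finite_subset by blast
  then have "contract (partner g i) (cblade g (- Y) S) U
    = (if partner g i \<in> S then sg (partner g i) S * cblade g (- Y) (S - {partner g i}) U else 0)"
    by (rule contract_cblade)
  moreover have "wedge i (cblade g (- Y) S) U = clifford g (- Y) i (cblade g (- Y) S) U
     + Y * (orient g i * contract (partner g i) (cblade g (- Y) S) U)"
    by (simp add: clifford_def)
  ultimately show ?thesis unfolding clifford_cblade[OF assms] by (simp add: mult_ac)
qed

lemma poly_eq_cblade:
  assumes "p \<in> carrier (free_gca g)" "S \<subseteq> {1..2*g}" "signed_monomial S (quantize g Y p)"
  obtains \<epsilon> where "\<epsilon> \<in> {1, -1}" "p = (\<lambda>U. \<epsilon> * cblade g (- Y) S U)"
proof -
  obtain \<epsilon> where \<epsilon>: "\<epsilon> \<in> {1, -1}" "quantize g Y p = (\<lambda>U. \<epsilon> * monomial S U)"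
    using assms(3) by (rule signed_monomialE)
  have "p = quantize g (- Y) (\<lambda>U. \<epsilon> * monomial S U)" using quantize_inverse[OF assms(1)] \<epsilon>(2) by simp
  also have "\<dots> = (\<lambda>U. \<epsilon> * cblade g (- Y) S U)"
    using assms(2) by (intro ext) (simp only: quantize_scale quantize_monomial)
  finally show ?thesis using that \<epsilon>(1) by blast
qed

subsection \<open>Generation and minimality\<close>

lemma genideal_stable_subset:
  assumes "gca_stable g C" "A \<subseteq> C"
  shows "Idl\<^bsub>free_gca g\<^esub> A \<subseteq> C"
proof -
  interpret ring "free_gca g" by (rule free_gca_ring)
  show ?thesis using gca_stable_ideal[OF assms(1)] assms(2) by (rule genideal_minimal)
qed

lemma monom_Suc_mult: "monom (1::rat) (Suc k) = Y * monom 1 k"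
  by (simp add: Y_monom mult_monom)

text \<open>The assumptions of \<open>pair_rules\<close> are verified for membership of y^k e_S in
  \<open>J\<close>; then an element of the kernel is expanded in the basis (e_S).\<close>

lemma macdonald_ideal_subset:
  assumes J: "ideal J (free_gca g)" and bound: "n + 2 \<le> 2 * g"
    and gens: "macdonald_polys g n \<subseteq> J" and extra: "even n \<Longrightarrow> extra_poly g n \<in> J"
  shows "macdonald_ideal g n \<subseteq> J"
proof -
  note scale = ideal_free_gca_closed(1)[OF J] and wedge = ideal_free_gca_closed(2)[OF J]
    and plus = ideal_free_gca_closed(3)[OF J]
  let ?e = "cblade g (- Y)"
  define Q where "Q S k \<longleftrightarrow> (\<lambda>U. monom 1 k * ?e S U) \<in> J" for S k
  \<comment> \<open>The coefficients to be cancelled are signs, hence their own inverses.\<close>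
  have unit: "(\<lambda>U. r * p U) \<in> J \<Longrightarrow> s * r = 1 \<Longrightarrow> p \<in> J" for r s p
    using scale[of "\<lambda>U. r * p U" s] by (simp flip: mult.assoc)
  have sg_unit: "sg i S * sg i S = (1 :: rat poly)" for i S by simp
  have os_unit: "(orient g i * sg j S) * (orient g i * sg j S) = (1 :: rat poly)" for i j S
    by (simp add: mult.left_commute mult.assoc)
  have wedge_Q: "(\<lambda>U. (if i \<in> S then 0 else sg i S * (monom 1 k * ?e (insert i S) U))
      + (if partner g i \<in> S then orient g i * sg (partner g i) S
          * (monom 1 (Suc k) * ?e (S - {partner g i}) U) else 0)) \<in> J"
    if "Q S k" "S \<subseteq> {1..2*g}" "i \<in> {1..2*g}" for S i k
  proof -
    have "wedge i (\<lambda>U. monom 1 k * ?e S U) \<in> J" using that wedge by (simp add: Q_def)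
    then have "(\<lambda>U. monom 1 k * wedge i (?e S) U) \<in> J" unfolding wedge_scale[abs_def] .
    then show ?thesis unfolding wedge_cblade[OF that(2,3)] monom_Suc_mult
      by (rule back_subst[of "\<lambda>f. f \<in> J"]) (auto simp: algebra_simps simp del: mult_pCons_left)
  qed
  have minus: "p \<in> J" if "(\<lambda>U. p U + q U) \<in> J" "q \<in> J" for p q
    using plus[OF that(1) scale[OF that(2), of "-1"]] by simp
  have minus': "q \<in> J" if "(\<lambda>U. p U + q U) \<in> J" "p \<in> J" for p q
    using plus[OF scale[OF that(2), of "-1"] that(1)] by simp
  define S0 where "S0 = {1..n div 2} \<union> (\<lambda>k. k + g) ` {1..n div 2}"
  interpret pair_rules g n Q S0
  proof
    fix S i k assume S: "S \<subseteq> {1..2*g}" and i: "i \<in> S" "partner g i \<in> S" and q: "Q S k"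
    have "(\<lambda>U. (orient g i * sg (partner g i) S)
          * (monom 1 (Suc k) * ?e (S - {partner g i}) U)) \<in> J"
      using wedge_Q[OF q S, of i] i S by auto
    from unit[OF this os_unit] show "Q (S - {partner g i}) (Suc k)" by (simp add: Q_def)
  next
    fix S i k assume S: "S \<subseteq> {1..2*g}" and i: "i \<in> {1..2*g}" "i \<notin> S" "partner g i \<notin> S" and q: "Q S k"
    have "(\<lambda>U. sg i S * (monom 1 k * ?e (insert i S) U)) \<in> J"
      using wedge_Q[OF q S, of i] i by simp
    from unit[OF this sg_unit] show "Q (insert i S) k" by (simp add: Q_def)
  next
    fix S i k assume S: "S \<subseteq> {1..2*g}" and i: "i \<in> {1..2*g}" "i \<notin> S" "partner g i \<notin> S"
      and q: "Q (insert (partner g i) S) k"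
    let ?T = "insert (partner g i) S"
    have T: "?T \<subseteq> {1..2*g}" using S partner_in[OF i(1)] by auto
    have iT: "i \<notin> ?T" using i not_sym[OF partner_neq[OF i(1)]] by simp
    have TS: "?T - {partner g i} = S" using i by auto
    \<comment> \<open>With \<open>i\<close> outside \<open>?T\<close> and its partner inside, both
      terms of the product with x_i are present. Reading this relation in the two directions gives
      \<open>lower\<close> and \<open>raise\<close>.\<close>
    have *: "(\<lambda>U. sg i ?T * (monom 1 k * ?e (insert i ?T) U)
        + (orient g i * sg (partner g i) ?T) * (monom 1 (Suc k) * ?e S U)) \<in> J"
      using wedge_Q[OF q T i(1)] iT unfolding TS by simp
    show "Q S (Suc k)" if "Q (insert i ?T) k"
    proof -
      have "(\<lambda>U. sg i ?T * (monom 1 k * ?e (insert i ?T) U)) \<in> J" using scale that by (simp add: Q_def)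
      then have "(\<lambda>U. (orient g i * sg (partner g i) ?T) * (monom 1 (Suc k) * ?e S U)) \<in> J"
        by (rule minus'[OF *])
      from unit[OF this os_unit] show ?thesis by (simp add: Q_def)
    qed
    show "Q (insert i ?T) k" if "Q S (Suc k)"
    proof -
      have "(\<lambda>U. (orient g i * sg (partner g i) ?T) * (monom 1 (Suc k) * ?e S U)) \<in> J"
        using scale that by (simp add: Q_def)
      from minus[OF * this] have "(\<lambda>U. sg i ?T * (monom 1 k * ?e (insert i ?T) U)) \<in> J" .
      from unit[OF this sg_unit] show ?thesis by (simp add: Q_def)
    qed
  next
    fix S k assume "Q S k"
    then show "Q S (Suc k)" using scale[of _ Y] unfolding Q_def monom_Suc_mult mult.assoc by blast
  next
    fix S :: "nat set" assume S: "S \<subseteq> {1..2*g}" "card S = Suc n"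
    then have "set_poly g S \<in> J" using gens unfolding macdonald_polys_eq by blast
    moreover obtain \<epsilon> where "\<epsilon> \<in> {1, -1}" "set_poly g S = (\<lambda>U. \<epsilon> * ?e S U)"
      using poly_eq_cblade[OF set_poly(1)[OF S(1)] S(1) set_poly(2)[OF S(1)]] .
    ultimately have "(\<lambda>U. \<epsilon> * ?e S U) \<in> J" "\<epsilon> * \<epsilon> = 1" by auto
    from unit[OF this] show "Q S 0" by (simp add: Q_def)
  next
    assume n: "even n"
    note ex = extra_poly[OF n bound, folded S0_def]
    obtain c where c: "signed_monomial S0 c" "quantize g Y (extra_poly g n) = (\<lambda>U. Y * c U)"
      using ex(5) by blast
    obtain \<epsilon> where \<epsilon>: "\<epsilon> \<in> {1, -1}" "c = (\<lambda>U. \<epsilon> * monomial S0 U)" using c(1) by (rule signed_monomialE)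
    have "extra_poly g n = quantize g (- Y) (\<lambda>U. Y * (\<epsilon> * monomial S0 U))"
      using quantize_inverse[OF ex(1)] c(2) \<epsilon>(2) by simp
    also have "\<dots> = (\<lambda>U. \<epsilon> * (Y * ?e S0 U))"
      by (intro ext) (simp only: quantize_scale quantize_monomial[OF ex(2)] mult.left_commute)
    finally have "(\<lambda>U. \<epsilon> * (Y * ?e S0 U)) \<in> J" using extra n by simp
    moreover have "\<epsilon> * \<epsilon> = 1" using \<epsilon>(1) by auto
    ultimately have "(\<lambda>U. Y * ?e S0 U) \<in> J" by (rule unit)
    then show "S0 \<subseteq> {1..2*g} \<and> partner_closed g S0 \<and> card S0 = n \<and> Q S0 1"
      using ex unfolding Q_def Y_monom by blast
  qed (rule bound)
  show ?thesis
  proof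
    fix p assume p: "p \<in> macdonald_ideal g n"
    let ?c = "quantize g Y p"
    have "p \<in> carrier (free_gca g)" using p unfolding macdonald_ideal_weight by (simp add: weight_ideal_def)
    then have "p = quantize g (- Y) ?c" by (simp only: quantize_inverse)
    then have eq: "p = (\<lambda>U. \<Sum>S\<in>Pow {1..2*g}. ?c S * ?e S U)" by (simp only: quantize_def[of g "- Y"])
    \<comment> \<open>The coordinate at \<open>S\<close> is divisible by the very power of y for
      which \<open>everywhere\<close> puts the multiple of e_S into \<open>J\<close>.\<close>
    have term_in: "(\<lambda>U. ?c S * ?e S U) \<in> J" if S: "S \<in> Pow {1..2*g}" for S
    proof -
      have "monom 1 (Suc n - card S) dvd ?c S"
        using p S unfolding macdonald_ideal_weight by (simp add: weight_ideal_def)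
      then obtain r where r: "?c S = r * monom 1 (Suc n - card S)" by (metis dvdE mult.commute)
      have "Q S (Suc n - card S)" using S everywhere by blast
      then show ?thesis unfolding Q_def r mult.assoc by (rule scale)
    qed
    have sums: "A \<subseteq> Pow {1..2*g} \<Longrightarrow> (\<lambda>U. \<Sum>S\<in>A. ?c S * ?e S U) \<in> J" if "finite A" for A
      using that
    proof (induction A rule: finite_induct)
      case empty
      show ?case using scale[OF term_in[of "{}"], of 0] by simp
    next
      case (insert S A)
      then show ?case using plus[OF term_in, of S "\<lambda>U. \<Sum>S\<in>A. ?c S * ?e S U"] by simp
    qed
    show "p \<in> J" by (subst eq, rule sums) simp_all
  qed
qed

section \<open>Membership and irredundancy of the generators\<close>

lemma macdonald_polys_in_ideal: "macdonald_polys g n \<subseteq> macdonald_ideal g n"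
proof
  fix p assume "p \<in> macdonald_polys g n"
  then obtain S where p: "p = set_poly g S" and S: "S \<subseteq> {1..2*g}" "card S = Suc n"
    unfolding macdonald_polys_eq by blast
  show "p \<in> macdonald_ideal g n"
    unfolding macdonald_ideal_weight p
    by (rule signed_monomial_weight_ideal[OF set_poly(1)[OF S(1)] _ set_poly(2)[OF S(1)], of 1])
      (simp_all add: S)
qed

text \<open>The weight of the Macdonald ideal, changed at \<open>T\<close> alone: for
  \<open>T\<close> with \<open>n + 1\<close> elements it rises from 0 to 1, which excludes
  e_T.\<close>

definition redundancy_weight :: "nat \<Rightarrow> nat set \<Rightarrow> nat set \<Rightarrow> nat" where
  "redundancy_weight n T S = (if S = T then 1 else Suc n - card S)"

text \<open>Removing a variable from \<open>T\<close> leads to weight 1 and adding one to weight 0,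
  so the conditions of \<open>weight_ideal_stable\<close> still hold at \<open>T\<close>.\<close>

lemma redundancy_stable:
  assumes "card T = Suc n"
  shows "gca_stable g (weight_ideal g (redundancy_weight n T))"
  using assms by (intro weight_ideal_stable) (auto simp: redundancy_weight_def card_weight)

text \<open>\<open>h\<close> is kept general because both the Macdonald weight and
  \<open>redundancy_weight\<close> are inserted for it.\<close>

lemma extra_poly_in_weight_ideal:
  assumes n: "even n" "n + 2 \<le> 2 * g" and h: "\<And>S. card S = n \<Longrightarrow> h S = 1"
  shows "extra_poly g n \<in> weight_ideal g h"
proof -
  note ex = extra_poly[OF n]
  obtain c where c: "signed_monomial ({1..n div 2} \<union> (\<lambda>k. k + g) ` {1..n div 2}) c"
    "quantize g Y (extra_poly g n) = (\<lambda>U. Y * c U)"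
    using ex(5) by blast
  show ?thesis
    by (rule signed_monomial_weight_ideal[OF ex(1) c(2) c(1)]) (simp only: h[OF ex(3)] Y_monom dvd_refl)
qed

text \<open>The ideal generated by \<open>A\<close> has all its coordinates at \<open>T\<close>
  divisible by y, while that of \<open>set_poly g T\<close> is a sign.\<close>

lemma set_poly_irredundant:
  assumes T: "T \<subseteq> {1..2*g}" "card T = Suc n" and A: "A \<subseteq> weight_ideal g (redundancy_weight n T)"
  shows "set_poly g T \<notin> Idl\<^bsub>free_gca g\<^esub> A"
  using genideal_stable_subset[OF redundancy_stable[OF T(2)] A]
    not_in_weight_ideal[OF T(1) set_poly(2)[OF T(1)], of "redundancy_weight n T"]
  by (auto simp: redundancy_weight_def)

lemma other_polys_in_weight_ideal:
  "macdonald_polys g n - {set_poly g T} \<subseteq> weight_ideal g (redundancy_weight n T)"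
proof
  fix p assume "p \<in> macdonald_polys g n - {set_poly g T}"
  then obtain S where p: "p = set_poly g S" and S: "S \<subseteq> {1..2*g}" "card S = Suc n" "S \<noteq> T"
    unfolding macdonald_polys_eq by blast
  show "p \<in> weight_ideal g (redundancy_weight n T)"
    unfolding p
    by (rule signed_monomial_weight_ideal[OF set_poly(1)[OF S(1)] _ set_poly(2)[OF S(1)], of 1])
      (simp_all add: S redundancy_weight_def)
qed

text \<open>\<open>p {}\<close> is the value at x = x' = 0, so this is the preimage of the ideal
  (y^m) of \<rat>[y].\<close>

definition constant_ideal :: "nat \<Rightarrow> nat \<Rightarrow> (nat set \<Rightarrow> rat poly) set" where
  "constant_ideal g m = {p \<in> carrier (free_gca g). monom 1 m dvd p {}}"

lemma constant_ideal_stable: "gca_stable g (constant_ideal g m)"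
  unfolding gca_stable_def constant_ideal_def
  by (auto simp: wedge_carrier) (auto simp: free_gca_carrier wedge_def parity_def)

lemma macdonald_poly_constant_term:
  assumes IJ: "I \<union> J \<noteq> {}" "I \<subseteq> {1..g}" "J \<subseteq> {1..g}" "K \<subseteq> {1..g}"
    "I \<inter> J = {}" "I \<inter> K = {}" "J \<inter> K = {}"
  shows "macdonald_poly g I J K {} = 0"
proof -
  have fin: "finite I" "finite J" using IJ by (meson finite_atLeastAtMost finite_subset)+
  let ?R = "\<lambda>xs. foldr (\<lambda>a b. a \<otimes>\<^bsub>free_gca g\<^esub> b) xs"
  have "(monomial {i} \<otimes>\<^bsub>free_gca g\<^esub> q) {} = (0 :: rat poly)" for i q
    by (simp add: monomial_mult)
  then have "xs \<noteq> [] \<Longrightarrow> ?R (map (\<lambda>i. monomial {i}) xs) p {} = (0 :: rat poly)" for xs p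
    by (cases xs) auto
  moreover have "sorted_list_of_set I @ map (\<lambda>j. j + g) (sorted_list_of_set J) \<noteq> []"
    using IJ(1) fin by auto
  moreover have "macdonald_poly g I J K =
      ?R (map (\<lambda>i. monomial {i}) (sorted_list_of_set I @ map (\<lambda>j. j + g) (sorted_list_of_set J)))
        (list_prod (free_gca g) (map (y_minus_xx' g) (sorted_list_of_set K)))"
    by (simp add: macdonald_poly_def list_prod_def var_x_monomial[abs_def] var_x'_monomial[abs_def] o_def)
  ultimately show ?thesis by metis
qed

text \<open>For even \<open>n\<close> the degree condition makes \<open>card I + card J\<close> odd,
  so each polynomial with \<open>q = 0\<close> has an odd variable as a factor and vanishes at x =
  x' = 0.\<close>

lemma extra_poly_irredundant:
  assumes n: "even n" "n + 2 \<le> 2 * g"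
  shows "extra_poly g n \<notin> Idl\<^bsub>free_gca g\<^esub> (macdonald_polys g n)"
proof -
  \<comment> \<open>One more than the exponent in the value of \<open>extra_poly g n\<close> at x =
    x' = 0.\<close>
  let ?m = "n div 2 + 2"
  have "macdonald_polys g n \<subseteq> constant_ideal g ?m"
  proof
    fix p assume "p \<in> macdonald_polys g n"
    then obtain I J K where p: "p = macdonald_poly g I J K"
      and *: "I \<subseteq> {1..g}" "J \<subseteq> {1..g}" "K \<subseteq> {1..g}" "I \<inter> J = {}" "I \<inter> K = {}" "J \<inter> K = {}"
      and card: "card I + card J + 2 * card K = n + 1"
      unfolding macdonald_polys_def by blast
    have "I \<union> J \<noteq> {}"
    proof
      assume "I \<union> J = {}"
      then have "2 * card K = n + 1" using card by simp
      then show False using n(1) by presburger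
    qed
    then have "p {} = 0" unfolding p using * by (rule macdonald_poly_constant_term)
    then show "p \<in> constant_ideal g ?m"
      using signed_monomial_macdonald_poly(1)[OF *] p by (simp add: constant_ideal_def)
  qed
  then have "Idl\<^bsub>free_gca g\<^esub> (macdonald_polys g n) \<subseteq> constant_ideal g ?m"
    by (rule genideal_stable_subset[OF constant_ideal_stable])
  moreover have "extra_poly g n \<notin> constant_ideal g ?m"
    using extra_poly(6)[OF n] by (auto simp: constant_ideal_def monom_1_dvd_iff')
  ultimately show ?thesis by blast
qed

lemma generated_macdonald_ideal:
  assumes "n + 2 \<le> 2 * g" and A: "macdonald_polys g n \<subseteq> A" "even n \<Longrightarrow> extra_poly g n \<in> A"
    "A \<subseteq> macdonald_ideal g n"
  shows "Idl\<^bsub>free_gca g\<^esub> A = macdonald_ideal g n"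
proof
  show "Idl\<^bsub>free_gca g\<^esub> A \<subseteq> macdonald_ideal g n"
    by (rule genideal_stable_subset[OF macdonald_ideal_stable A(3)])
  interpret ring "free_gca g" by (rule free_gca_ring)
  have "A \<subseteq> carrier (free_gca g)" using A(3) gca_stableD(1)[OF macdonald_ideal_stable] by blast
  then have "ideal (Idl\<^bsub>free_gca g\<^esub> A) (free_gca g)" "A \<subseteq> Idl\<^bsub>free_gca g\<^esub> A"
    using genideal_ideal genideal_self by auto
  then show "macdonald_ideal g n \<subseteq> Idl\<^bsub>free_gca g\<^esub> A"
    using assms by (intro macdonald_ideal_subset) auto
qed

lemma irredundant_psubset:
  assumes A: "A \<subseteq> macdonald_ideal g n" and p: "p \<in> A" "p \<notin> Idl\<^bsub>free_gca g\<^esub> (A - {p})"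
  shows "Idl\<^bsub>free_gca g\<^esub> (A - {p}) \<subset> macdonald_ideal g n"
  using genideal_stable_subset[OF macdonald_ideal_stable, of "A - {p}" g n] assms by blast

theorem theorem2:
  fixes g n :: nat
  assumes "g \<ge> 1" and "n \<ge> 2"
  shows "(odd n \<and> 3 \<le> n \<and> n + 3 \<le> 2 * g \<longrightarrow>
            card (macdonald_polys g n) = (2 * g) choose (n + 1) \<and>
            Idl\<^bsub>free_gca g\<^esub> (macdonald_polys g n) = macdonald_ideal g n \<and>
            (\<forall>p \<in> macdonald_polys g n.
               Idl\<^bsub>free_gca g\<^esub> (macdonald_polys g n - {p}) \<subset> macdonald_ideal g n))
       \<and> (even n \<and> 2 \<le> n \<and> n + 2 \<le> 2 * g \<longrightarrow>
            card (insert (extra_poly g n) (macdonald_polys g n)) = ((2 * g) choose (n + 1)) + 1 \<and>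
            Idl\<^bsub>free_gca g\<^esub> (insert (extra_poly g n) (macdonald_polys g n)) = macdonald_ideal g n \<and>
            (\<forall>p \<in> insert (extra_poly g n) (macdonald_polys g n).
               Idl\<^bsub>free_gca g\<^esub> (insert (extra_poly g n) (macdonald_polys g n) - {p})
                 \<subset> macdonald_ideal g n))"
proof (intro conjI impI ballI; (elim conjE)?)
  let ?M = "macdonald_polys g n"
  show "card ?M = (2 * g) choose (n + 1)" by (rule card_macdonald_polys)
  assume odd: "odd n" "n + 3 \<le> 2 * g"
  \<comment> \<open>For odd \<open>n\<close> the premise of \<open>generated_macdonald_ideal\<close>
    on \<open>extra_poly\<close> holds vacuously.\<close>
  show "Idl\<^bsub>free_gca g\<^esub> ?M = macdonald_ideal g n"
    using odd macdonald_polys_in_ideal by (intro generated_macdonald_ideal) auto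
  fix p assume p: "p \<in> ?M"
  then obtain T where T: "T \<subseteq> {1..2*g}" "card T = Suc n" "p = set_poly g T"
    unfolding macdonald_polys_eq by blast
  show "Idl\<^bsub>free_gca g\<^esub> (?M - {p}) \<subset> macdonald_ideal g n"
    using macdonald_polys_in_ideal p
    by (rule irredundant_psubset)
      (use set_poly_irredundant[OF T(1,2) other_polys_in_weight_ideal] T(3) in simp)
next
  let ?M = "macdonald_polys g n" and ?x = "extra_poly g n"
  assume n: "even n" "n + 2 \<le> 2 * g"
  have x: "?x \<notin> Idl\<^bsub>free_gca g\<^esub> ?M" using n by (rule extra_poly_irredundant)
  interpret ring "free_gca g" by (rule free_gca_ring)
  have "?M \<subseteq> carrier (free_gca g)"
    using macdonald_polys_in_ideal gca_stableD(1)[OF macdonald_ideal_stable] by blast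
  \<comment> \<open>The additional polynomial differs from all others, so the count rises by exactly
    one.\<close>
  then have xM: "?x \<notin> ?M" using x genideal_self by blast
  have "finite ?M" unfolding macdonald_polys_eq by simp
  then show "card (insert ?x ?M) = ((2 * g) choose (n + 1)) + 1"
    using xM card_macdonald_polys[of g n] by simp
  have sub: "insert ?x ?M \<subseteq> macdonald_ideal g n"
    using macdonald_polys_in_ideal extra_poly_in_weight_ideal[OF n, of "\<lambda>S. Suc n - card S"]
    by (simp add: macdonald_ideal_weight)
  show "Idl\<^bsub>free_gca g\<^esub> (insert ?x ?M) = macdonald_ideal g n"
    using n sub by (intro generated_macdonald_ideal) auto
  fix p assume p: "p \<in> insert ?x ?M"
  have "p \<notin> Idl\<^bsub>free_gca g\<^esub> (insert ?x ?M - {p})"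
  proof (cases "p = ?x")
    case True
    then have "insert ?x ?M - {p} = ?M" using xM by auto
    then show ?thesis using True x by simp
  next
    case False
    then obtain T where T: "T \<subseteq> {1..2*g}" "card T = Suc n" "p = set_poly g T"
      using p unfolding macdonald_polys_eq by blast
    \<comment> \<open>\<open>T\<close> has \<open>n + 1\<close> elements, so sets of
      \<open>n\<close> elements keep weight 1, which the factor y of the additional polynomial
      meets.\<close>
    have "?x \<in> weight_ideal g (redundancy_weight n T)"
      using n by (rule extra_poly_in_weight_ideal) (use T in \<open>auto simp: redundancy_weight_def\<close>)
    then have "insert ?x ?M - {p} \<subseteq> weight_ideal g (redundancy_weight n T)"
      using other_polys_in_weight_ideal[of g n T] T(3) by blast
    from set_poly_irredundant[OF T(1,2) this] show ?thesis using T(3) by simp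
  qed
  with sub p show "Idl\<^bsub>free_gca g\<^esub> (insert ?x ?M - {p}) \<subset> macdonald_ideal g n"
    by (rule irredundant_psubset)
qed

end
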